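(* Let $H$ be a fixed finite simple graph with at least one edge. Assume $K_n$ is equipped with positive i.i.d. edge weights $Z_e$ with some common cdf $\tilde G$ satisfying $\lim_{x\to0}\tilde G(x)/x=1$ (i.e. $\tilde G(x)=x+o(x)$ as $x\to 0^+$). Let $\tilde F_H(m,n)$ and $\tilde C_H(m,n)$ denote the minimum weight of an $(m/n,H)$-factor and of an $(m/n,H)$-cover, respectively, with respect to the weights $Z_e$. Then the weights $Z_e$ can be coupled to i.i.d. $\mathrm{Exp}(1)$ edge weights $X_e$ in such a way that, for any $m=m(n)$ with $\lim_{n\to\infty}m/n<1$, $$\frac{\tilde F_H(m,n)}{F_H(m,n)}\to 1\ \text{ in probability}\qquad\text{and}\qquad \frac{\tilde C_H(m,n)}{C_H(m,n)}\to 1\ \text{ in probability}$$ as $n\to\infty$, where $F_H(m,n)$ and $C_H(m,n)$ are the corresponding minimum weights with respect to the weights $X_e$ (for the statement about factors, $n$ ranges over multiples of $v_H$).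
   Context: $v_H$ is the number of vertices of $H$. An $(\alpha,H)$-cover on $K_n$ is a collection $Q$ of (not necessarily induced) subgraphs of $K_n$, each isomorphic to $H$, such that at most $\alpha n$ vertices of $K_n$ are not covered by any $H'\in Q$. An $(\alpha,H)$-factor is an $(\alpha,H)$-cover whose members are pairwise vertex-disjoint. Given edge weights $(x_e)$, the weight of $Q$ is $\sum_{H'\in Q}\sum_{e\in\mathcal{E}(H')}x_e$, where $\mathcal{E}(H')$ is the edge set of $H'$ (an edge lying in several copies is counted once for each such copy). $F_H(m,n)$ (resp. $C_H(m,n)$) is the minimum weight of an $(m/n,H)$-factor (resp. $(m/n,H)$-cover) on $K_n$. *)

theory Defs
  imports "HOL-Probability.Probability"
begin

section \<open>Finite simple graphs\<close>

text \<open>A graph is a pair of a vertex set and a set of edges, each edge being a two-element set of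
  vertices. The vertex set is kept explicit, so isolated vertices are allowed and matter.\<close>

type_synonym 'a graph = "'a set \<times> 'a set set"

abbreviation verts :: "'a graph \<Rightarrow> 'a set" where "verts \<equiv> fst"
abbreviation edges :: "'a graph \<Rightarrow> 'a set set" where "edges \<equiv> snd"

definition finite_simple_graph :: "'a graph \<Rightarrow> bool" where
  "finite_simple_graph H \<longleftrightarrow> finite (verts H) \<and> (\<forall>e\<in>edges H. e \<subseteq> verts H \<and> card e = 2)"

definition subgraph :: "'a graph \<Rightarrow> 'a graph \<Rightarrow> bool" where
  "subgraph H' G \<longleftrightarrow>
     verts H' \<subseteq> verts G \<and> edges H' \<subseteq> edges G \<and> (\<forall>e\<in>edges H'. e \<subseteq> verts H')"

definition graph_isomorphic :: "'a graph \<Rightarrow> 'b graph \<Rightarrow> bool" where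
  "graph_isomorphic H H' \<longleftrightarrow>
     (\<exists>f. bij_betw f (verts H) (verts H') \<and> edges H' = (\<lambda>e. f ` e) ` edges H)"

definition complete_graph :: "nat \<Rightarrow> nat graph" where
  "complete_graph n = ({..<n}, {e. e \<subseteq> {..<n} \<and> card e = 2})"

section \<open>Covers and factors\<close>

definition H_cover :: "'a graph \<Rightarrow> real \<Rightarrow> nat \<Rightarrow> nat graph set \<Rightarrow> bool" where
  "H_cover H \<alpha> n Q \<longleftrightarrow>
     (\<forall>H'\<in>Q. subgraph H' (complete_graph n) \<and> graph_isomorphic H H') \<and>
     real (card (verts (complete_graph n) - (\<Union>H'\<in>Q. verts H'))) \<le> \<alpha> * real n"

definition H_factor :: "'a graph \<Rightarrow> real \<Rightarrow> nat \<Rightarrow> nat graph set \<Rightarrow> bool" where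
  "H_factor H \<alpha> n Q \<longleftrightarrow> H_cover H \<alpha> n Q \<and> disjoint_family_on verts Q"

definition total_weight :: "(nat set \<Rightarrow> real) \<Rightarrow> nat graph set \<Rightarrow> real" where
  "total_weight w Q = (\<Sum>H'\<in>Q. \<Sum>e\<in>edges H'. w e)"

text \<open>The sets below are finite. For \<open>m \<ge> 0\<close> there is always a factor if \<open>n\<close> is a multiple of the
  number of vertices of \<open>H\<close>, and a cover if \<open>n\<close> is at least that number; the junk value \<open>Min {}\<close>
  can occur only for other \<open>n\<close>.\<close>

definition min_factor_weight :: "'a graph \<Rightarrow> real \<Rightarrow> nat \<Rightarrow> (nat set \<Rightarrow> real) \<Rightarrow> real" where
  "min_factor_weight H m n w = Min (total_weight w ` {Q. H_factor H (m / real n) n Q})"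

definition min_cover_weight :: "'a graph \<Rightarrow> real \<Rightarrow> nat \<Rightarrow> (nat set \<Rightarrow> real) \<Rightarrow> real" where
  "min_cover_weight H m n w = Min (total_weight w ` {Q. H_cover H (m / real n) n Q})"

section \<open>Probabilistic notions\<close>

definition is_coupling :: "('a \<times> 'b) measure \<Rightarrow> 'a measure \<Rightarrow> 'b measure \<Rightarrow> bool" where
  "is_coupling P A B \<longleftrightarrow>
     prob_space P \<and> sets P = sets (A \<Otimes>\<^sub>M B) \<and> distr P A fst = A \<and> distr P B snd = B"

text \<open>Convergence in probability to a constant; the variables may live on different spaces.\<close>

definition tendsto_in_prob ::
  "(nat \<Rightarrow> 'a measure) \<Rightarrow> (nat \<Rightarrow> 'a \<Rightarrow> real) \<Rightarrow> real \<Rightarrow> nat filter \<Rightarrow> bool" where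
  "tendsto_in_prob P Y c F \<longleftrightarrow>
     (\<forall>n. Y n \<in> borel_measurable (P n)) \<and>
     (\<forall>\<epsilon>>0. ((\<lambda>n. measure (P n) {\<omega> \<in> space (P n). \<bar>Y n \<omega> - c\<bar> > \<epsilon>}) \<longlongrightarrow> 0) F)"

definition weight_law :: "nat \<Rightarrow> 'w measure \<Rightarrow> (nat set \<Rightarrow> 'w \<Rightarrow> real) \<Rightarrow> (nat set \<Rightarrow> real) measure" where
  "weight_law n M Z =
     distr M (\<Pi>\<^sub>M e\<in>edges (complete_graph n). borel) (\<lambda>\<omega>. \<lambda>e\<in>edges (complete_graph n). Z e \<omega>)"

definition exp_weight_law :: "nat \<Rightarrow> (nat set \<Rightarrow> real) measure" where
  "exp_weight_law n = (\<Pi>\<^sub>M e\<in>edges (complete_graph n). density lborel (exponential_density 1))"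

end

theory Submission
  imports Defs "HOL-Real_Asymp.Real_Asymp"
begin

text \<open>The weights are coupled by the quantile transform: \<open>Z\<^sub>e = \<phi> (X\<^sub>e)\<close> with \<open>\<phi>\<close> monotone and
  \<open>\<phi> x / x \<rightarrow> 1\<close> as \<open>x \<rightarrow> 0\<close>. Fix \<open>\<delta> > 0\<close> and choose \<open>r\<close> such that \<open>X\<^sub>e\<close> and \<open>Z\<^sub>e\<close> agree up to a
  factor \<open>1 + \<delta>\<close> whenever \<open>X\<^sub>e \<le> r\<close>. Beyond \<open>r\<close> nothing is known except a lower bound (\<open>Z\<^sub>e\<close> may even
  have infinite mean), so the point is that an optimal factor or cover, for either weighting, can be
  rearranged to avoid all edges with \<open>X\<^sub>e > r\<close> while its weight grows by a factor at most
  \<open>1 + \<delta>\<close>. Such a rearrangement bounds one minimum by \<open>(1 + \<delta>)\<^sup>2\<close> times the other, and the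
  situation is symmetric in \<open>X\<close> and \<open>Z\<close> (\<open>factor_transfer\<close>, \<open>cover_transfer\<close>).

  The rearrangement uses that a copy of \<open>H\<close> with a heavy edge costs at least a constant \<open>\<theta>\<close>
  (about \<open>r / 2\<close>), while for a much smaller constant \<open>\<eta>\<close> the edges with \<open>X\<^sub>e \<le> \<eta>\<close> still form a
  random graph of constant density. Exchanging one heavy copy for at most \<open>v\<^sup>2\<close> new copies in this
  light graph, where \<open>v\<close> is the number of vertices of \<open>H\<close>, costs \<open>O(\<eta>)\<close>, which is at most \<open>\<delta> \<theta>\<close>. For
  covers this is immediate, since every vertex lies in a light clique of size \<open>v\<close>. For factors the
  vertex set \<open>U\<close> of the heavy copy has to be exchanged against other members of the factor, about
  which nothing is known. Members of the factor are read as rows of an array of vertices. If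
  \<open>v * (v - 1)\<close> rows are such that any two are joined by light edges in every column, then
  every column spans a light clique; if moreover the first entries of \<open>v - 1\<close> of these rows are light
  neighbours of the first vertex of \<open>U\<close>, those of \<open>v - 1\<close> further rows are neighbours of the second,
  and so on, then \<open>U\<close> together with all the rows splits into light cliques of size \<open>v\<close>
  (\<open>absorbing_if_linked_rows\<close>). Suitable rows exist in every array of linear size at once: a fixed
  array contains of order \<open>n\<^sup>2\<close> edge-disjoint candidates, so it fails with probability
  \<open>exp (- \<Omega>(n\<^sup>2))\<close>, which beats the number \<open>n ^ n\<close> of arrays (\<open>robust_whp\<close>).

  Exchanges need that only few copies are heavy. The light graph itself contains a perfect factor: cover
  greedily by light cliques, complete arbitrarily, and repair the few copies of the completion
  (\<open>exists_perfect_factor_in_robust\<close>). Applied with a yet smaller constant \<open>\<eta>'\<close> in place of \<open>\<eta>\<close>, this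
  bounds the optimal weight, hence the number of heavy copies, by a small multiple of \<open>n\<close>.\<close>

section \<open>Exchanging a set of vertices against rows of an array\<close>

definition clique_in :: "nat set set \<Rightarrow> nat set \<Rightarrow> bool" where
  "clique_in S T \<longleftrightarrow> (\<forall>a\<in>T. \<forall>b\<in>T. a \<noteq> b \<longrightarrow> {a, b} \<in> S)"

text \<open>The exchange property: \<open>R\<close> stands for the vertex sets of the light members of a factor and
  \<open>U\<close> for the vertex set of a heavy member. Some members \<open>R0\<close> are given up, and the vertices of \<open>U\<close>
  and \<open>R0\<close> are redistributed among cliques in \<open>S\<close>. The number of new sets is bounded independently
  of \<open>n\<close>, which bounds the price of an exchange.\<close>

definition absorbing :: "nat \<Rightarrow> nat \<Rightarrow> nat \<Rightarrow> nat set set \<Rightarrow> bool" where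
  "absorbing n v \<tau> S \<longleftrightarrow> (\<forall>U R.
     U \<subseteq> {..<n} \<and> card U = v \<and> (\<forall>r\<in>R. r \<subseteq> {..<n} \<and> card r = v \<and> r \<inter> U = {}) \<and> disjoint R \<and>
     (\<forall>u\<in>U. \<tau> \<le> card ({w. {u, w} \<in> S} \<inter> \<Union>R)) \<longrightarrow>
     (\<exists>R0\<subseteq>R. \<exists>T. card T \<le> v\<^sup>2 \<and> finite T \<and> disjoint T \<and> (\<forall>t\<in>T. card t = v \<and> clique_in S t) \<and>
        \<Union>T = U \<union> \<Union>R0))"

text \<open>All that the deterministic part of the argument uses about the random graph \<open>S\<close> of light
  edges; \<open>\<tau>\<close> will be a small multiple of \<open>n\<close>. The factor 4 leaves every vertex \<open>2 * \<tau>\<close> neighbours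
  after up to \<open>\<tau>\<close> uncovered vertices and up to \<open>\<tau>\<close> vertices of heavy copies are disregarded.\<close>

definition robust :: "nat \<Rightarrow> nat \<Rightarrow> nat \<Rightarrow> nat set set \<Rightarrow> bool" where
  "robust n v \<tau> S \<longleftrightarrow>
     (\<forall>u<n. 4 * \<tau> \<le> card {w\<in>{..<n}. {u, w} \<in> S}) \<and>
     (\<forall>W\<subseteq>{..<n}. \<tau> \<le> card W \<longrightarrow> (\<exists>T\<subseteq>W. card T = v \<and> clique_in S T)) \<and>
     absorbing n v \<tau> S"

text \<open>The array \<open>x\<close> consists of \<open>s\<close> blocks of \<open>L\<close> rows of length \<open>v\<close>; one row is chosen from each
  block.\<close>

definition linked_rows :: "nat \<Rightarrow> nat \<Rightarrow> nat \<Rightarrow> nat set set \<Rightarrow> (nat \<times> nat \<times> nat \<Rightarrow> nat) \<Rightarrow> bool" where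
  "linked_rows s L v S x \<longleftrightarrow> (\<exists>r. (\<forall>i<s. r i < L) \<and>
     (\<forall>i<s. \<forall>j<s. i < j \<longrightarrow> (\<forall>c<v. {x (i, r i, c), x (j, r j, c)} \<in> S)))"

definition arrays :: "nat \<Rightarrow> nat \<Rightarrow> nat \<Rightarrow> nat \<Rightarrow> (nat \<times> nat \<times> nat \<Rightarrow> nat) set" where
  "arrays s L v n = {x \<in> ({..<s} \<times> {..<L} \<times> {..<v}) \<rightarrow>\<^sub>E {..<n}. inj_on x ({..<s} \<times> {..<L} \<times> {..<v})}"

text \<open>Hall's theorem in its most wasteful form: with this many candidates for every index a greedy
  choice succeeds.\<close>

lemma injective_choice:
  assumes "finite I" "\<And>i. i \<in> I \<Longrightarrow> card I \<le> card (F i)"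
  shows "\<exists>f. inj_on f I \<and> (\<forall>i\<in>I. f i \<in> F i)"
proof -
  have "\<exists>f. inj_on f J \<and> (\<forall>i\<in>J. f i \<in> F i)" if "finite J" "J \<subseteq> I" for J
    using that
  proof (induction J rule: finite_induct)
    case (insert j J)
    then obtain f where f: "inj_on f J" "\<forall>i\<in>J. f i \<in> F i" by auto
    have "card (f ` J) \<le> card J" using insert by (simp add: card_image_le)
    also have "\<dots> < card (insert j J)" using insert by simp
    also have "\<dots> \<le> card I" using insert assms(1) by (intro card_mono) auto
    also have "\<dots> \<le> card (F j)" using insert assms(2) by auto
    finally have "\<not> F j \<subseteq> f ` J"
      using insert card_mono[of "f ` J" "F j"] by auto
    then obtain y where y: "y \<in> F j" "y \<notin> f ` J" by auto
    have "inj_on (f(j := y)) (insert j J)"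
      using f(1) y(2) insert.hyps by (auto simp: inj_on_def)
    moreover have "\<forall>i\<in>insert j J. (f(j := y)) i \<in> F i"
      using f(2) y(1) insert.hyps by auto
    ultimately show ?case by blast
  qed auto
  then show ?thesis using assms(1) by auto
qed

lemma clique_in_dense:
  assumes sel: "\<And>x. x \<in> arrays s L v n \<Longrightarrow> linked_rows s L v S x"
    and "v \<le> s" "0 < v" "s * L * v \<le> card W" "W \<subseteq> {..<n}"
  shows "\<exists>T\<subseteq>W. card T = v \<and> clique_in S T"
proof -
  let ?D = "{..<s} \<times> {..<L} \<times> {..<v}"
  have fW: "finite W" using assms(5) finite_subset by blast
  have "card ?D \<le> card W" using assms(4) by (simp add: card_cartesian_product mult.assoc)
  then obtain x0 where x0: "inj_on x0 ?D" "x0 ` ?D \<subseteq> W"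
    using card_le_inj[OF _ fW, of ?D] by auto
  define x where "x = restrict x0 ?D"
  have x: "inj_on x ?D" "x ` ?D \<subseteq> W" using x0 by (auto simp: x_def inj_on_def)
  have "x \<in> arrays s L v n"
    unfolding arrays_def using x x0 assms(5) by (auto simp: x_def PiE_iff extensional_def)
  then obtain r where r: "\<And>i. i < s \<Longrightarrow> r i < L"
    and adj: "\<And>i j c. i < s \<Longrightarrow> j < s \<Longrightarrow> i < j \<Longrightarrow> c < v \<Longrightarrow> {x (i, r i, c), x (j, r j, c)} \<in> S"
    using sel[of x] unfolding linked_rows_def by metis
  let ?g = "\<lambda>i. x (i, r i, 0)"
  have inj: "inj_on ?g {..<v}"
  proof (rule inj_onI)
    fix i j assume "i \<in> {..<v}" "j \<in> {..<v}" "?g i = ?g j"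
    then show "i = j"
      using inj_onD[OF x(1), of "(i, r i, 0)" "(j, r j, 0)"] r assms(2,3) by auto
  qed
  have "clique_in S (?g ` {..<v})"
    unfolding clique_in_def
  proof safe
    fix i j assume "i < v" "j < v" "?g i \<noteq> ?g j"
    then show "{?g i, ?g j} \<in> S"
      using adj[of i j 0] adj[of j i 0] assms(2,3)
      by (cases i j rule: linorder_cases) (auto simp: insert_commute)
  qed
  moreover have "?g ` {..<v} \<subseteq> W" using x(2) r assms(2,3) by auto
  ultimately show ?thesis using inj
    by (intro exI[of _ "?g ` {..<v}"]) (auto simp: card_image)
qed

lemma card_meeting_blocks:
  assumes "finite R" "\<And>r. r \<in> R \<Longrightarrow> card r = v \<and> finite r" "k * v \<le> card (N \<inter> \<Union>R)" "0 < v"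
  shows "k \<le> card {r\<in>R. r \<inter> N \<noteq> {}}"
proof -
  let ?M = "{r\<in>R. r \<inter> N \<noteq> {}}"
  have "card (N \<inter> \<Union>R) \<le> card (\<Union>?M)"
    using assms by (intro card_mono) auto
  also have "\<dots> \<le> (\<Sum>r\<in>?M. card r)"
    by (rule card_Union_le_sum_card)
  also have "\<dots> = card ?M * v" using assms by simp
  finally show ?thesis using assms(3,4) by (meson le_trans mult_le_cancel2)
qed

text \<open>Block \<open>i\<close> of the array is filled with members of \<open>R\<close> that meet the neighbourhood of the vertex
  \<open>u\<close> of \<open>U\<close> with index \<open>i div (v - 1)\<close>, ordered so that a neighbour of that vertex comes first. The
  rows chosen by \<open>linked_rows\<close> are denoted \<open>z k j\<close>, with \<open>k < v\<close> and \<open>j < v - 1\<close>. The first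
  column is used up by the sets \<open>A k = {u k, z k 0 0, z k 1 0, \<dots>}\<close>, and column \<open>c \<ge> 1\<close> by the sets
  \<open>B (j, c) = {z 0 j c, z 1 j c, \<dots>}\<close>. All these sets have \<open>v\<close> elements and meet every row at most
  once, so that no edge inside a row, about which nothing is known, is needed.\<close>

lemma absorbing_if_linked_rows:
  assumes sel: "\<And>x. x \<in> arrays (v * (v - 1)) L v n \<Longrightarrow> linked_rows (v * (v - 1)) L v S x"
    and v: "2 \<le> v" and \<tau>: "v * (v - 1) * L * v \<le> \<tau>"
  shows "absorbing n v \<tau> S"
  unfolding absorbing_def
proof (intro allI impI, elim conjE)
  fix U :: "nat set" and R :: "nat set set"
  assume U: "U \<subseteq> {..<n}" "card U = v"
    and R: "\<forall>r\<in>R. r \<subseteq> {..<n} \<and> card r = v \<and> r \<inter> U = {}" "disjoint R"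
    and N: "\<forall>u\<in>U. \<tau> \<le> card ({w. {u, w} \<in> S} \<inter> \<Union>R)"
  define s where "s = v * (v - 1)"
  have finU: "finite U" using U finite_subset by blast
  have finR: "finite R"
    by (rule finite_subset[of _ "Pow {..<n}"]) (use R in auto)
  have finr: "finite r" if "r \<in> R" for r using R that finite_subset by blast
  obtain u where u: "bij_betw u {..<v} U"
    using U(2) finU by (metis ex_bij_betw_nat_finite atLeast0LessThan)
  have uU: "u k \<in> U" if "k < v" for k using u that by (auto simp: bij_betw_def)
  let ?k = "\<lambda>i. i div (v - 1)"
  have k: "?k i < v" if "i < s" for i
    using that v by (simp add: s_def less_mult_imp_div_less)
  let ?N = "\<lambda>k. {w. {u k, w} \<in> S}"
  define F where "F = (\<lambda>(i, l::nat). {r\<in>R. r \<inter> ?N (?k i) \<noteq> {}})"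
  have "card ({..<s} \<times> {..<L}) \<le> card (F il)" if il_in: "il \<in> {..<s} \<times> {..<L}" for il
  proof -
    obtain i l where il: "il = (i, l)" "i < s" "l < L"
      by (rule SigmaE[OF il_in]) simp
    have "s * L * v \<le> card (?N (?k i) \<inter> \<Union>R)"
      using N uU[OF k[OF il(2)]] \<tau> by (metis s_def le_trans)
    then show ?thesis
      using card_meeting_blocks[of R v "s * L" "?N (?k i)"] finR R finr v il
      by (simp add: F_def)
  qed
  then obtain f where f: "inj_on f ({..<s} \<times> {..<L})"
    and fF: "\<And>il. il \<in> {..<s} \<times> {..<L} \<Longrightarrow> f il \<in> F il"
    using injective_choice[of "{..<s} \<times> {..<L}" F] by auto
  have fR: "f (i, l) \<in> R" if "i < s" "l < L" for i l
    using fF[of "(i, l)"] that by (auto simp: F_def)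
  \<comment> \<open>Each selected member is ordered, beginning with a neighbour of its vertex of \<open>U\<close>.\<close>
  have "\<exists>g. bij_betw g {..<v} (f (i, l)) \<and> g 0 \<in> ?N (?k i)" if il: "i < s" "l < L" for i l
  proof -
    obtain w where w: "w \<in> f (i, l)" "w \<in> ?N (?k i)"
      using fF[of "(i, l)"] il by (auto simp: F_def)
    obtain h where h: "bij_betw h {..<v} (f (i, l))"
      using fR[OF il] R finr by (metis ex_bij_betw_nat_finite atLeast0LessThan)
    then obtain j where j: "j < v" "h j = w" using w(1) by (force simp: bij_betw_def)
    have "bij_betw (h \<circ> Transposition.transpose 0 j) {..<v} (f (i, l))"
      using h j v by (intro bij_betw_trans[OF _ h] bij_betw_transpose_iff) auto
    then show ?thesis using j w(2) by (intro exI[of _ "h \<circ> Transposition.transpose 0 j"]) auto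
  qed
  then obtain g where g: "\<And>i l. i < s \<Longrightarrow> l < L \<Longrightarrow> bij_betw (g i l) {..<v} (f (i, l))"
    and g0: "\<And>i l. i < s \<Longrightarrow> l < L \<Longrightarrow> g i l 0 \<in> ?N (?k i)"
    by metis
  let ?D = "{..<s} \<times> {..<L} \<times> {..<v}"
  define x where "x = restrict (\<lambda>(i, l, c). g i l c) ?D"
  have gf: "g i l c \<in> f (i, l)" if "i < s" "l < L" "c < v" for i l c
    using g[of i l] that by (auto simp: bij_betw_def)
  have g_inj: "i = i' \<and> l = l' \<and> c = c'"
    if "i < s" "l < L" "c < v" "i' < s" "l' < L" "c' < v" "g i l c = g i' l' c'"
    for i l c i' l' c'
  proof -
    have "f (i, l) \<inter> f (i', l') \<noteq> {}" using gf[OF that(1-3)] gf[OF that(4-6)] that(7) by auto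
    then have "f (i, l) = f (i', l')"
      using R(2) fR that unfolding disjoint_def by blast
    then have "i = i'" "l = l'" using inj_onD[OF f, of "(i, l)" "(i', l')"] that by auto
    moreover have "c = c'"
      using g[of i l] that calculation by (auto simp: bij_betw_def inj_on_def)
    ultimately show ?thesis by simp
  qed
  have "x \<in> arrays s L v n"
    unfolding arrays_def
  proof (intro CollectI conjI PiE_I)
    show "inj_on x ?D" unfolding x_def by (auto simp: inj_on_def dest: g_inj)
  next
    fix p assume "p \<in> ?D"
    then show "x p \<in> {..<n}" using gf fR R(1) by (force simp: x_def)
  qed (auto simp: x_def)
  then obtain r where r: "\<And>i. i < s \<Longrightarrow> r i < L"
    and adj0: "\<And>i j c. i < s \<Longrightarrow> j < s \<Longrightarrow> i < j \<Longrightarrow> c < v \<Longrightarrow> {x (i, r i, c), x (j, r j, c)} \<in> S"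
    using sel[of x] unfolding linked_rows_def s_def by metis
  define y where "y i c = g i (r i) c" for i c
  have adj: "{y i c, y j c} \<in> S" if "i < s" "j < s" "i \<noteq> j" "c < v" for i j c
    using adj0[of i j c] adj0[of j i c] that r unfolding x_def y_def
    by (cases i j rule: linorder_cases) (auto simp: insert_commute)
  have y_inj: "i = i' \<and> c = c'" if "i < s" "c < v" "i' < s" "c' < v" "y i c = y i' c'" for i c i' c'
    using g_inj[of i "r i" c i' "r i'" c'] that r by (auto simp: y_def)
  have y_row: "y i ` {..<v} = f (i, r i)" if "i < s" for i
    using g[OF that r[OF that]] by (auto simp: y_def bij_betw_def)
  have yU: "y i c \<notin> U" if "i < s" "c < v" for i c
    using y_row[OF that(1)] fR[OF that(1) r[OF that(1)]] R(1) that by blast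
  \<comment> \<open>From here on the blocks are indexed by pairs \<open>(k, j)\<close> instead of \<open>i = k * (v - 1) + j\<close>.\<close>
  let ?i = "\<lambda>k j. k * (v - 1) + j"
  have i_less: "?i k j < s" if "k < v" "j < v - 1" for k j
  proof -
    have "?i k j < Suc k * (v - 1)" using that by simp
    also have "\<dots> \<le> v * (v - 1)" using that by (intro mult_le_mono1) simp
    finally show ?thesis by (simp add: s_def)
  qed
  have i_inj: "k = k' \<and> j = j'" if "j < v - 1" "j' < v - 1" "?i k j = ?i k' j'" for k k' j j'
  proof -
    have "?i k j div (v - 1) = k" "?i k' j' div (v - 1) = k'"
      "?i k j mod (v - 1) = j" "?i k' j' mod (v - 1) = j'" using that(1,2) by auto
    then show ?thesis using that by metis
  qed
  have i_k: "?k (?i k j) = k" if "j < v - 1" for k j using that by simp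
  have i_surj: "\<exists>k<v. \<exists>j<v - 1. i = ?i k j" if "i < s" for i
  proof -
    have "i = ?i (?k i) (i mod (v - 1))" by (rule div_mult_mod_eq[symmetric])
    moreover have "i mod (v - 1) < v - 1" using v by simp
    ultimately show ?thesis using k[OF that] by blast
  qed
  define z where "z k j c = y (?i k j) c" for k j c
  have z_inj: "k = k' \<and> j = j' \<and> c = c'"
    if "k < v" "j < v - 1" "c < v" "k' < v" "j' < v - 1" "c' < v" "z k j c = z k' j' c'"
    for k j c k' j' c'
    using y_inj[OF i_less _ i_less, of k j c k' j' c'] i_inj[of j j' k k'] that unfolding z_def by blast
  have z_adj: "{z k j c, z k' j' c} \<in> S"
    if "k < v" "j < v - 1" "c < v" "k' < v" "j' < v - 1" "(k, j) \<noteq> (k', j')" for k j c k' j'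
    using adj[OF i_less i_less, of k j k' j' c] i_inj[of j j' k k'] that unfolding z_def by blast
  have zU: "z k j c \<notin> U" if "k < v" "j < v - 1" "c < v" for k j c
    using yU[OF i_less] that by (auto simp: z_def)
  have uz: "{u k, z k j 0} \<in> S" if "k < v" "j < v - 1" for k j
    using g0[OF i_less[OF that] r[OF i_less[OF that]]] i_k[OF that(2), of k] by (simp add: z_def y_def)
  define A where "A k = insert (u k) ((\<lambda>j. z k j 0) ` {..<v - 1})" for k
  define B where "B = (\<lambda>(j, c). (\<lambda>k. z k j c) ` {..<v})"
  define T where "T = A ` {..<v} \<union> B ` ({..<v - 1} \<times> {1..<v})"
  define R0 where "R0 = (\<lambda>i. f (i, r i)) ` {..<s}"
  have v0: "0 < v" using v by simp
  have finT: "finite T" by (simp add: T_def)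
  have cardT: "card T \<le> v\<^sup>2"
  proof -
    have "card T \<le> card (A ` {..<v}) + card (B ` ({..<v - 1} \<times> {1..<v}))"
      unfolding T_def by (rule card_Un_le)
    also have "\<dots> \<le> v + (v - 1) * (v - 1)"
      using card_image_le[of "{..<v}" A] card_image_le[of "{..<v - 1} \<times> {1..<v}" B]
      by (simp add: card_cartesian_product)
    also have "\<dots> \<le> v + (v - 1) * v" by (intro add_left_mono mult_le_mono2) simp
    also have "\<dots> = v\<^sup>2" using v by (cases v) (auto simp: power2_eq_square algebra_simps)
    finally show ?thesis .
  qed
  have cardA: "card (A k) = v \<and> clique_in S (A k)" if "k < v" for k
  proof
    have "inj_on (\<lambda>j. z k j 0) {..<v - 1}"
      by (rule inj_onI) (use z_inj[OF that _ v0 that _ v0] in auto)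
    moreover have "u k \<notin> (\<lambda>j. z k j 0) ` {..<v - 1}" using zU uU that v0 by fastforce
    ultimately show "card (A k) = v" using v by (simp add: A_def card_image)
    show "clique_in S (A k)"
      unfolding clique_in_def A_def
    proof safe
      fix j j' assume "j < v - 1" "j' < v - 1" "z k j 0 \<noteq> z k j' 0"
      then show "{z k j 0, z k j' 0} \<in> S" using z_adj[OF that _ v0 that] by auto
    qed (use uz[OF that] in \<open>auto simp: insert_commute\<close>)
  qed
  have cardB: "card (B (j, c)) = v \<and> clique_in S (B (j, c))" if "j < v - 1" "c < v" for j c
  proof
    have "inj_on (\<lambda>k. z k j c) {..<v}"
      by (rule inj_onI) (use z_inj[OF _ that _ that] in auto)
    then show "card (B (j, c)) = v" by (simp add: B_def card_image)
    show "clique_in S (B (j, c))"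
      unfolding clique_in_def B_def prod.case
    proof safe
      fix k k' assume "k < v" "k' < v" "z k j c \<noteq> z k' j c"
      then show "{z k j c, z k' j c} \<in> S" using z_adj[OF _ that(1,2) _ that(1)] by auto
    qed
  qed
  have T_cases: "(\<exists>k<v. t = A k) \<or> (\<exists>j<v - 1. \<exists>c<v. 1 \<le> c \<and> t = B (j, c))" if "t \<in> T" for t
    using that unfolding T_def
    by (elim UnE imageE SigmaE) (metis lessThan_iff, metis atLeastLessThan_iff lessThan_iff)
  have "disjoint T"
  proof -
    have u_inj: "k = k'" if "k < v" "k' < v" "u k = u k'" for k k'
      using u that by (auto simp: bij_betw_def inj_on_def)
    have AA: "A k \<inter> A k' = {}" if "k < v" "k' < v" "A k \<noteq> A k'" for k k'
    proof (rule ccontr)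
      assume "A k \<inter> A k' \<noteq> {}"
      then obtain p where p: "p \<in> A k" "p \<in> A k'" by blast
      have "k = k'"
      proof (cases "p = u k \<or> p = u k'")
        case True
        then have "p \<in> U" using uU that by auto
        moreover have "z l j 0 \<notin> U" if "l < v" "j < v - 1" for l j
          using zU that v0 by blast
        ultimately have "p = u k" "p = u k'" using p that(1,2) by (auto simp: A_def)
        then show ?thesis using u_inj that by metis
      next
        case False
        then obtain j j' where "j < v - 1" "j' < v - 1" "p = z k j 0" "p = z k' j' 0"
          using p by (auto simp: A_def)
        then show ?thesis using z_inj[of k j 0 k' j' 0] that v0 by auto
      qed
      then show False using that(3) by simp
    qed
    have AB: "A k \<inter> B (j, c) = {}" if "k < v" "j < v - 1" "c < v" "1 \<le> c" for k j c
    proof (rule ccontr)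
      assume "A k \<inter> B (j, c) \<noteq> {}"
      then obtain p where p: "p \<in> A k" "p \<in> B (j, c)" by blast
      obtain l where l: "l < v" "p = z l j c" using p(2) by (auto simp: B_def)
      have "p \<noteq> u k" using l zU[of l j c] uU[of k] that by auto
      then obtain j' where "j' < v - 1" "p = z k j' 0" using p(1) by (auto simp: A_def)
      then show False using z_inj[of k j' 0 l j c] l that v0 by auto
    qed
    have BB: "B (j, c) \<inter> B (j', c') = {}"
      if "j < v - 1" "c < v" "j' < v - 1" "c' < v" "B (j, c) \<noteq> B (j', c')" for j c j' c'
      using that z_inj[of _ j c _ j' c'] by (auto simp: B_def)
    show ?thesis
      unfolding disjoint_def
    proof (intro ballI impI)
      fix a b assume ab: "a \<in> T" "b \<in> T" "a \<noteq> b"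
      show "a \<inter> b = {}"
        using T_cases[OF ab(1)] T_cases[OF ab(2)]
      proof (elim disjE exE conjE)
        fix k k' assume "k < v" "k' < v" "a = A k" "b = A k'"
        then show ?thesis using AA ab(3) by blast
      next
        fix k j c assume "k < v" "a = A k" "j < v - 1" "c < v" "1 \<le> c" "b = B (j, c)"
        then show ?thesis using AB by blast
      next
        fix k j c assume "k < v" "b = A k" "j < v - 1" "c < v" "1 \<le> c" "a = B (j, c)"
        then show ?thesis using AB by blast
      next
        fix j c j' c' assume "j < v - 1" "c < v" "a = B (j, c)" "j' < v - 1" "c' < v" "b = B (j', c')"
        then show ?thesis using BB ab(3) by blast
      qed
    qed
  qed
  moreover have "\<Union>T = U \<union> \<Union>R0"
  proof -
    have R0: "\<Union>R0 = {z k j c | k j c. k < v \<and> j < v - 1 \<and> c < v}" (is "_ = ?Z")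
    proof -
      have "\<Union>R0 = (\<Union>i<s. y i ` {..<v})" unfolding R0_def using y_row by simp
      also have "\<dots> = ?Z"
      proof safe
        fix i c assume "i < s" "c < v"
        then show "\<exists>k j c'. y i c = z k j c' \<and> k < v \<and> j < v - 1 \<and> c' < v"
          using i_surj[of i] unfolding z_def by blast
      next
        fix k j c assume "k < v" "j < v - 1" "c < v"
        then show "z k j c \<in> (\<Union>i<s. y i ` {..<v})"
          using i_less[of k j] unfolding z_def by blast
      qed
      finally show ?thesis .
    qed
    show ?thesis
      unfolding R0
    proof (intro subset_antisym subsetI)
      fix p assume "p \<in> \<Union>T"
      then obtain t where t: "t \<in> T" "p \<in> t" by blast
      from T_cases[OF t(1)] show "p \<in> U \<union> ?Z"
      proof (elim disjE exE conjE)
        fix k assume k: "k < v" "t = A k"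
        show ?thesis
        proof (cases "p = u k")
          case False
          then obtain j where "j < v - 1" "p = z k j 0" using t(2) k(2) by (auto simp: A_def)
          then show ?thesis using k(1) v0 by blast
        qed (use uU k in simp)
      next
        fix j c assume jc: "j < v - 1" "c < v" "t = B (j, c)"
        then obtain k where "k < v" "p = z k j c" using t(2) by (auto simp: B_def)
        then show ?thesis using jc(1,2) by blast
      qed
    next
      fix p assume "p \<in> U \<union> ?Z"
      then show "p \<in> \<Union>T"
      proof
        assume "p \<in> U"
        then obtain k where "k < v" "p = u k" using u by (auto simp: bij_betw_def)
        then show ?thesis unfolding T_def A_def by blast
      next
        assume "p \<in> ?Z"
        then obtain k j c where p: "p = z k j c" "k < v" "j < v - 1" "c < v" by blast
        show ?thesis
        proof (cases "c = 0")
          case True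
          then have "p \<in> A k" using p by (auto simp: A_def)
          then show ?thesis using p(2) unfolding T_def by blast
        next
          case False
          then have "(j, c) \<in> {..<v - 1} \<times> {1..<v}" using p by auto
          moreover have "p \<in> B (j, c)" using p by (auto simp: B_def)
          ultimately show ?thesis unfolding T_def by blast
        qed
      qed
    qed
  qed
  moreover have "R0 \<subseteq> R" using fR r by (auto simp: R0_def)
  moreover have "\<forall>t\<in>T. card t = v \<and> clique_in S t" using cardA cardB by (auto simp: T_def)
  ultimately show "\<exists>R0\<subseteq>R. \<exists>T. card T \<le> v\<^sup>2 \<and> finite T \<and> disjoint T \<and>
      (\<forall>t\<in>T. card t = v \<and> clique_in S t) \<and> \<Union>T = U \<union> \<Union>R0"
    using finT cardT by blast
qed

section \<open>The graph of light edges\<close>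

lemma (in prob_space) prob_no_full_block:
  fixes X :: "'e \<Rightarrow> 'a \<Rightarrow> real"
  assumes ind: "indep_vars (\<lambda>_. borel) X E"
    and p: "\<And>e. e \<in> E \<Longrightarrow> prob {x\<in>space M. X e x \<le> \<eta>} = p" "0 \<le> p" "p \<le> 1"
    and B: "finite B" "disjoint_family_on K B"
    and K: "\<And>b. b \<in> B \<Longrightarrow> K b \<subseteq> E \<and> finite (K b) \<and> card (K b) \<le> t"
  shows "prob {x\<in>space M. \<forall>b\<in>B. \<exists>e\<in>K b. \<not> X e x \<le> \<eta>} \<le> (1 - p ^ t) ^ card B"
proof (cases "B = {}")
  case True
  then show ?thesis by simp
next
  case False
  have rv: "X e \<in> borel_measurable M" if "e \<in> E" for e
    using ind that by (simp add: indep_vars_def)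
  define Xr where "Xr = (\<lambda>b \<omega>. restrict (\<lambda>e. X e \<omega>) (K b))"
  define A where "A b = {y\<in>space (PiM (K b) (\<lambda>_. borel :: real measure)). \<exists>e\<in>K b. \<not> y e \<le> \<eta>}" for b
  have Xr: "indep_vars (\<lambda>b. PiM (K b) (\<lambda>_. borel)) Xr B"
    unfolding Xr_def by (rule indep_vars_restrict[OF ind]) (use K B in auto)
  have A: "A b \<in> sets (PiM (K b) (\<lambda>_. borel))" if "b \<in> B" for b
  proof -
    have [measurable]: "(\<lambda>y. y e) \<in> borel_measurable (PiM (K b) (\<lambda>_. borel))" if "e \<in> K b" for e
      using that by (rule measurable_component_singleton)
    have "A b = (\<Union>e\<in>K b. {y\<in>space (PiM (K b) (\<lambda>_. borel :: real measure)). \<not> y e \<le> \<eta>})"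
      unfolding A_def by auto
    also have "\<dots> \<in> sets (PiM (K b) (\<lambda>_. borel))"
      using K[OF that] by (intro sets.finite_UN) auto
    finally show ?thesis .
  qed
  have vim: "Xr b -` A b \<inter> space M = {x\<in>space M. \<exists>e\<in>K b. \<not> X e x \<le> \<eta>}" for b
    unfolding Xr_def A_def by (auto simp: space_PiM)
  have "{x\<in>space M. \<forall>b\<in>B. \<exists>e\<in>K b. \<not> X e x \<le> \<eta>} = (\<Inter>b\<in>B. Xr b -` A b \<inter> space M)"
    using False unfolding vim by auto
  also have "prob \<dots> = (\<Prod>b\<in>B. prob (Xr b -` A b \<inter> space M))"
    using Xr False B(1) A by (intro indep_varsD_finite) auto
  also have "\<dots> \<le> (\<Prod>b\<in>B. 1 - p ^ t)"
  proof (rule prod_mono, safe)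
    fix b assume b: "b \<in> B"
    let ?G = "{x\<in>space M. \<forall>e\<in>K b. X e x \<le> \<eta>}"
    have "prob ?G = p ^ card (K b)"
    proof (cases "K b = {}")
      case True
      then show ?thesis by (simp add: prob_space)
    next
      case False
      have "?G = (\<Inter>e\<in>K b. X e -` {..\<eta>} \<inter> space M)" using False by auto
      also have "prob \<dots> = (\<Prod>e\<in>K b. prob (X e -` {..\<eta>} \<inter> space M))"
        using ind K[OF b] False by (intro indep_varsD) auto
      also have "\<dots> = (\<Prod>e\<in>K b. p)"
      proof (rule prod.cong[OF refl])
        fix e assume "e \<in> K b"
        moreover have "X e -` {..\<eta>} \<inter> space M = {x\<in>space M. X e x \<le> \<eta>}" by auto
        ultimately show "prob (X e -` {..\<eta>} \<inter> space M) = p" using p(1) K[OF b] by auto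
      qed
      finally show ?thesis by simp
    qed
    also have "\<dots> \<ge> p ^ t" using p K[OF b] by (intro power_decreasing) auto
    finally have ge: "p ^ t \<le> prob ?G" .
    have G: "?G \<in> events"
    proof -
      have [measurable]: "X e \<in> borel_measurable M" if "e \<in> K b" for e using rv K[OF b] that by auto
      have "?G = space M - (\<Union>e\<in>K b. {x\<in>space M. \<not> X e x \<le> \<eta>})" by auto
      also have "\<dots> \<in> events" using K[OF b] by (intro sets.Diff sets.finite_UN) auto
      finally show ?thesis .
    qed
    have "Xr b -` A b \<inter> space M = space M - ?G" unfolding vim by auto
    then show "prob (Xr b -` A b \<inter> space M) \<le> 1 - p ^ t" using prob_compl[OF G] ge by simp
  qed (simp)
  finally show ?thesis by simp
qed

lemma finite_complete_edges [simp]: "finite (edges (complete_graph n))"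
  by (rule finite_subset[of _ "Pow {..<n}"]) (auto simp: complete_graph_def)

text \<open>The edges needed for the choice of row \<open>a + i * b\<close> in block \<open>i\<close> to be linked. Two different
  lines \<open>i \<mapsto> a + i * b\<close> meet at most once, so no pair of rows belongs to two of these choices: the
  \<open>q\<^sup>2\<close> choices with \<open>a, b < q\<close> are independent of each other.\<close>

definition progression_edges ::
  "(nat \<times> nat \<times> nat \<Rightarrow> nat) \<Rightarrow> nat \<Rightarrow> nat \<Rightarrow> nat \<times> nat \<Rightarrow> nat set set" where
  "progression_edges x s v = (\<lambda>(a, b).
     (\<lambda>(i, j, c). {x (i, a + i * b, c), x (j, a + j * b, c)}) ` {(i, j, c). i < j \<and> j < s \<and> c < v})"

lemma progression_bound:
  fixes a b i s q :: nat
  assumes "a < q" "b < q" "i < s"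
  shows "a + i * b < s * q"
proof -
  have "a + i * b < q + i * q" using assms by (intro add_less_le_mono mult_le_mono2) auto
  also have "\<dots> = Suc i * q" by simp
  also have "\<dots> \<le> s * q" using assms(3) by (intro mult_le_mono1) simp
  finally show ?thesis .
qed

lemma progression_edges_sub:
  assumes x: "x \<in> arrays s (s * q) v n" and "ab \<in> {..<q} \<times> {..<q}"
  shows "progression_edges x s v ab \<subseteq> edges (complete_graph n) \<and>
    finite (progression_edges x s v ab) \<and> card (progression_edges x s v ab) \<le> s * s * v"
proof -
  obtain a b where ab: "ab = (a, b)" "a < q" "b < q" using assms(2) by auto
  let ?J = "{(i, j, c). i < j \<and> j < s \<and> c < v}"
  have J: "?J \<subseteq> {..<s} \<times> {..<s} \<times> {..<v}" by auto
  then have fJ: "finite ?J" by (rule finite_subset) auto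
  have "card ?J \<le> card ({..<s} \<times> {..<s} \<times> {..<v})" using J by (intro card_mono) auto
  then have cJ: "card ?J \<le> s * s * v" by (simp add: card_cartesian_product)
  have "{x (i, a + i * b, c), x (j, a + j * b, c)} \<in> edges (complete_graph n)"
    if "i < j" "j < s" "c < v" for i j c
  proof -
    have "(i, a + i * b, c) \<in> {..<s} \<times> {..<s * q} \<times> {..<v}"
      "(j, a + j * b, c) \<in> {..<s} \<times> {..<s * q} \<times> {..<v}"
      using that progression_bound[OF ab(2,3)] by auto
    moreover from this have "x (i, a + i * b, c) \<noteq> x (j, a + j * b, c)"
      using x that(1) unfolding arrays_def inj_on_def by blast
    ultimately show ?thesis using x unfolding arrays_def complete_graph_def PiE_iff by auto
  qed
  then have "progression_edges x s v ab \<subseteq> edges (complete_graph n)"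
    unfolding progression_edges_def ab(1) by auto
  moreover have "card (progression_edges x s v ab) \<le> s * s * v"
    unfolding progression_edges_def ab(1) prod.case using card_image_le[OF fJ] cJ le_trans by blast
  ultimately show ?thesis using finite_subset finite_complete_edges by blast
qed

lemma progression_edges_disjoint:
  assumes x: "x \<in> arrays s (s * q) v n"
  shows "disjoint_family_on (progression_edges x s v) ({..<q} \<times> {..<q})"
  unfolding disjoint_family_on_def
proof (intro ballI impI)
  fix ab ab' assume AB: "ab \<in> {..<q} \<times> {..<q}" "ab' \<in> {..<q} \<times> {..<q}" "ab \<noteq> ab'"
  obtain a b where ab: "ab = (a, b)" "a < q" "b < q" using AB(1) by auto
  obtain a' b' where ab': "ab' = (a', b')" "a' < q" "b' < q" using AB(2) by auto
  have inj: "i = i' \<and> l = l' \<and> c = c'"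
    if "x (i, l, c) = x (i', l', c')" "i < s" "l < s * q" "c < v" "i' < s" "l' < s * q" "c' < v"
    for i l c i' l' c'
    using x that unfolding arrays_def inj_on_def by blast
  show "progression_edges x s v ab \<inter> progression_edges x s v ab' = {}"
  proof (rule ccontr)
    assume "progression_edges x s v ab \<inter> progression_edges x s v ab' \<noteq> {}"
    then obtain e where "e \<in> progression_edges x s v ab" "e \<in> progression_edges x s v ab'" by blast
    then obtain i j c i' j' c' where ij: "i < j" "j < s" "c < v" "i' < j'" "j' < s" "c' < v"
      and e: "e = {x (i, a + i * b, c), x (j, a + j * b, c)}"
        "e = {x (i', a' + i' * b', c'), x (j', a' + j' * b', c')}"
      unfolding progression_edges_def ab(1) ab'(1) by auto
    have i_less: "i < s" "i' < s" using ij by auto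
    note bd = progression_bound[OF ab(2,3)] progression_bound[OF ab'(2,3)]
    from e have "x (i, a + i * b, c) = x (i', a' + i' * b', c') \<and> x (j, a + j * b, c) = x (j', a' + j' * b', c') \<or>
      x (i, a + i * b, c) = x (j', a' + j' * b', c') \<and> x (j, a + j * b, c) = x (i', a' + i' * b', c')"
      by (auto simp: doubleton_eq_iff)
    then have "i = i' \<and> a + i * b = a' + i' * b' \<and> j = j' \<and> a + j * b = a' + j' * b' \<or> i = j' \<and> j = i'"
      using inj bd ij i_less by meson
    then have eq: "a + i * b = a' + i * b'" "a + j * b = a' + j * b'" using ij by auto
    define d where "d = j - i"
    have d: "j = i + d" "0 < d" using ij by (auto simp: d_def)
    have "a + i * b + d * b = a' + i * b' + d * b'"
      using eq(2) unfolding d(1) by (simp add: add_mult_distrib)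
    then have "d * b = d * b'" using eq(1) by linarith
    then have "b = b'" using d(2) by simp
    then show False using eq(1) AB(3) ab(1) ab'(1) by simp
  qed
qed

lemma linked_rows_if_full_progression:
  assumes "ab \<in> {..<q} \<times> {..<q}" "progression_edges x s v ab \<subseteq> S"
  shows "linked_rows s (s * q) v S x"
proof -
  obtain a b where ab: "ab = (a, b)" "a < q" "b < q" using assms(1) by auto
  show ?thesis unfolding linked_rows_def
  proof (intro exI[of _ "\<lambda>i. a + i * b"] conjI allI impI)
    fix i j c assume "i < s" "j < s" "i < j" "c < v"
    then have "(i, j, c) \<in> {(i, j, c). i < j \<and> j < s \<and> c < v}" by simp
    then show "{x (i, a + i * b, c), x (j, a + j * b, c)} \<in> S"
      using assms(2) unfolding progression_edges_def ab(1) by force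
  qed (use progression_bound ab in auto)
qed

lemma finite_arrays: "finite (arrays s L v n)"
  by (rule finite_subset[of _ "({..<s} \<times> {..<L} \<times> {..<v}) \<rightarrow>\<^sub>E {..<n}"])
    (auto simp: arrays_def intro!: finite_PiE)

text \<open>An injective array has at most \<open>n\<close> entries.\<close>

lemma card_arrays_le: "card (arrays s L v n) \<le> n ^ n"
proof (cases "arrays s L v n = {}")
  case False
  let ?D = "{..<s} \<times> {..<L} \<times> {..<v}"
  obtain x where "x \<in> arrays s L v n" using False by auto
  then have x: "inj_on x ?D" "x ` ?D \<subseteq> {..<n}" by (auto simp: arrays_def)
  have D: "card ?D \<le> n" using card_inj_on_le[OF x] by simp
  have "card (arrays s L v n) \<le> card (?D \<rightarrow>\<^sub>E {..<n})"
    unfolding arrays_def by (intro card_mono finite_PiE) auto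
  also have "\<dots> = n ^ card ?D" by (simp add: card_PiE)
  also have "\<dots> \<le> n ^ n" using D by (cases "n = 0") (auto intro: power_increasing)
  finally show ?thesis .
qed simp

abbreviation exp_law :: "real measure" where
  "exp_law \<equiv> density lborel (exponential_density 1)"

lemma prob_space_exp_law: "prob_space exp_law"
  by (rule prob_space_exponential_density) simp

lemma prob_exp_law_le: "0 \<le> a \<Longrightarrow> measure exp_law {..a} = 1 - exp (- a)"
proof -
  assume a: "0 \<le> a"
  interpret prob_space exp_law by (rule prob_space_exp_law)
  have "distributed exp_law lborel (\<lambda>x. x) (exponential_density 1)"
    unfolding distributed_def by (auto simp: distr_id2 exponential_density_nonneg)
  from exponential_distributedD_le[OF this a] show ?thesis
    by (simp add: atMost_def)
qed

lemma prob_space_exp_weight_law: "prob_space (exp_weight_law n)"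
  unfolding exp_weight_law_def by (intro prob_space_PiM prob_space_exp_law)

lemma space_exp_weight_law: "space (exp_weight_law n) = edges (complete_graph n) \<rightarrow>\<^sub>E UNIV"
  by (simp add: exp_weight_law_def space_PiM)

lemma sets_exp_weight_law: "sets (exp_weight_law n) = sets (\<Pi>\<^sub>M e\<in>edges (complete_graph n). borel)"
  unfolding exp_weight_law_def by (intro sets_PiM_cong) auto

lemma measurable_exp_weight [measurable]:
  assumes "e \<in> edges (complete_graph n)"
  shows "(\<lambda>x. x e) \<in> borel_measurable (exp_weight_law n)"
  unfolding measurable_cong_sets[OF sets_exp_weight_law refl]
  using assms by (rule measurable_component_singleton)

lemma distr_exp_weight:
  "e \<in> edges (complete_graph n) \<Longrightarrow> distr (exp_weight_law n) borel (\<lambda>x. x e) = exp_law"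
proof -
  assume e: "e \<in> edges (complete_graph n)"
  have "distr (exp_weight_law n) borel (\<lambda>x. x e) = distr (exp_weight_law n) exp_law (\<lambda>x. x e)"
    by (intro distr_cong) auto
  also have "\<dots> = exp_law"
    unfolding exp_weight_law_def by (rule distr_PiM_component) (use e prob_space_exp_law in auto)
  finally show ?thesis .
qed

lemma indep_exp_weights:
  "prob_space.indep_vars (exp_weight_law n) (\<lambda>_. borel) (\<lambda>e x. x e) (edges (complete_graph n))"
proof -
  interpret prob_space "exp_weight_law n" by (rule prob_space_exp_weight_law)
  let ?E = "edges (complete_graph n)"
  show ?thesis
  proof (cases "?E = {}")
    case True
    then show ?thesis by (simp add: indep_vars_def indep_sets_def)
  next
    case False
    have "distr (exp_weight_law n) (PiM ?E (\<lambda>_. borel)) (\<lambda>x. \<lambda>e\<in>?E. x e) =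
        distr (exp_weight_law n) (exp_weight_law n) (\<lambda>x. x)"
      by (intro distr_cong) (auto simp: sets_exp_weight_law space_exp_weight_law PiE_def extensional_restrict)
    also have "\<dots> = (\<Pi>\<^sub>M e\<in>?E. exp_law)" by (simp add: distr_id2 exp_weight_law_def)
    also have "\<dots> = (\<Pi>\<^sub>M e\<in>?E. distr (exp_weight_law n) borel (\<lambda>x. x e))"
      by (intro PiM_cong) (auto simp: distr_exp_weight)
    finally show ?thesis
      using indep_vars_iff_distr_eq_PiM'[OF False, where M' = "\<lambda>_. borel :: real measure" and X = "\<lambda>e x. x e"] by simp
  qed
qed

lemma prob_exp_weight_le:
  assumes "e \<in> edges (complete_graph n)" "0 \<le> \<eta>"
  shows "measure (exp_weight_law n) {x\<in>space (exp_weight_law n). x e \<le> \<eta>} = 1 - exp (- \<eta>)"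
proof -
  have "measure (exp_weight_law n) {x\<in>space (exp_weight_law n). x e \<le> \<eta>} =
      measure (distr (exp_weight_law n) borel (\<lambda>x. x e)) {..\<eta>}"
    using assms by (subst measure_distr) (auto intro!: arg_cong[where f = "measure _"])
  also have "\<dots> = 1 - exp (- \<eta>)" using assms by (simp add: distr_exp_weight prob_exp_law_le)
  finally show ?thesis .
qed

definition light_edges :: "nat \<Rightarrow> real \<Rightarrow> (nat set \<Rightarrow> real) \<Rightarrow> nat set set" where
  "light_edges n \<eta> x = {e\<in>edges (complete_graph n). x e \<le> \<eta>}"

text \<open>The graph of light edges takes finitely many values, so every property of it is measurable.\<close>

lemma light_edges_event:
  "{x\<in>space (exp_weight_law n). \<Phi> (light_edges n \<eta> x)} \<in> sets (exp_weight_law n)"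
proof -
  let ?E = "edges (complete_graph n)" and ?N = "exp_weight_law n"
  have "{x\<in>space ?N. \<Phi> (light_edges n \<eta> x)} =
      (\<Union>S\<in>{S\<in>Pow ?E. \<Phi> S}. {x\<in>space ?N. \<forall>e\<in>?E. (x e \<le> \<eta>) = (e \<in> S)})"
  proof safe
    fix x assume "x \<in> space ?N" "\<Phi> (light_edges n \<eta> x)"
    then show "x \<in> (\<Union>S\<in>{S\<in>Pow ?E. \<Phi> S}. {x\<in>space ?N. \<forall>e\<in>?E. (x e \<le> \<eta>) = (e \<in> S)})"
      by (intro UN_I[of "light_edges n \<eta> x"]) (auto simp: light_edges_def)
  next
    fix x S assume *: "S \<subseteq> ?E" "\<Phi> S" "\<forall>e\<in>?E. (x e \<le> \<eta>) = (e \<in> S)"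
    then have "light_edges n \<eta> x = S" unfolding light_edges_def by blast
    then show "\<Phi> (light_edges n \<eta> x)" using * by simp
  qed
  also have "\<dots> \<in> sets ?N"
  proof (intro sets.finite_UN)
    fix S
    have "{x\<in>space ?N. \<forall>e\<in>?E. (x e \<le> \<eta>) = (e \<in> S)} =
       space ?N - (\<Union>e\<in>?E. {x\<in>space ?N. (x e \<le> \<eta>) \<noteq> (e \<in> S)})" by auto
    also have "\<dots> \<in> sets ?N" by (intro sets.Diff sets.finite_UN) auto
    finally show "{x\<in>space ?N. \<forall>e\<in>?E. (x e \<le> \<eta>) = (e \<in> S)} \<in> sets ?N" .
  qed auto
  finally show ?thesis .
qed

text \<open>Union bound over all arrays; for a fixed array the \<open>q\<^sup>2\<close> choices along lines are independent.\<close>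

lemma prob_not_linked:
  assumes "0 \<le> \<eta>"
  shows "measure (exp_weight_law n) {x\<in>space (exp_weight_law n).
      \<exists>y\<in>arrays s (s * q) v n. \<not> linked_rows s (s * q) v (light_edges n \<eta> x) y}
    \<le> real n ^ n * (1 - (1 - exp (- \<eta>)) ^ (s * s * v)) ^ (q * q)"
proof -
  interpret prob_space "exp_weight_law n" by (rule prob_space_exp_weight_law)
  let ?N = "exp_weight_law n" and ?A = "arrays s (s * q) v n"
  let ?r = "(1 - (1 - exp (- \<eta>)) ^ (s * s * v)) ^ (q * q)"
  have r: "0 \<le> ?r" using assms by (intro zero_le_power) (simp add: power_le_one)
  have "prob {x\<in>space ?N. \<exists>y\<in>?A. \<not> linked_rows s (s * q) v (light_edges n \<eta> x) y}
      = prob (\<Union>y\<in>?A. {x\<in>space ?N. \<not> linked_rows s (s * q) v (light_edges n \<eta> x) y})"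
    by (intro arg_cong[where f = prob]) auto
  also have "\<dots> \<le> (\<Sum>y\<in>?A. prob {x\<in>space ?N. \<not> linked_rows s (s * q) v (light_edges n \<eta> x) y})"
    using light_edges_event by (intro finite_measure_subadditive_finite finite_arrays) auto
  also have "\<dots> \<le> (\<Sum>y\<in>?A. ?r)"
  proof (rule sum_mono)
    fix y assume y: "y \<in> ?A"
    let ?B = "{..<q} \<times> {..<q}"
    have sub: "{x\<in>space ?N. \<not> linked_rows s (s * q) v (light_edges n \<eta> x) y} \<subseteq>
       {x\<in>space ?N. \<forall>b\<in>?B. \<exists>e\<in>progression_edges y s v b. \<not> x e \<le> \<eta>}"
    proof (intro subsetI, elim CollectE conjE, intro CollectI conjI ballI)
      fix x b assume "\<not> linked_rows s (s * q) v (light_edges n \<eta> x) y" and b: "b \<in> ?B"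
      then obtain e where "e \<in> progression_edges y s v b" "e \<notin> light_edges n \<eta> x"
        using linked_rows_if_full_progression[OF b] by blast
      then show "\<exists>e\<in>progression_edges y s v b. \<not> x e \<le> \<eta>"
        using progression_edges_sub[OF y b] unfolding light_edges_def by blast
    qed
    have ev: "{x\<in>space ?N. \<forall>b\<in>?B. \<exists>e\<in>progression_edges y s v b. \<not> x e \<le> \<eta>} \<in> events"
    proof -
      have "{x\<in>space ?N. \<forall>b\<in>?B. \<exists>e\<in>progression_edges y s v b. \<not> x e \<le> \<eta>} =
        {x\<in>space ?N. \<forall>b\<in>?B. \<exists>e\<in>progression_edges y s v b. e \<notin> light_edges n \<eta> x}"
        using progression_edges_sub[OF y] unfolding light_edges_def by blast
      then show ?thesis using light_edges_event[of n "\<lambda>S. \<forall>b\<in>?B. \<exists>e\<in>progression_edges y s v b. e \<notin> S"] by simp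
    qed
    have "prob {x\<in>space ?N. \<not> linked_rows s (s * q) v (light_edges n \<eta> x) y} \<le>
      prob {x\<in>space ?N. \<forall>b\<in>?B. \<exists>e\<in>progression_edges y s v b. \<not> x e \<le> \<eta>}"
      using sub ev by (rule finite_measure_mono)
    also have "\<dots> \<le> (1 - (1 - exp (- \<eta>)) ^ (s * s * v)) ^ card ?B"
      using assms progression_edges_sub[OF y] progression_edges_disjoint[OF y]
      by (intro prob_no_full_block[OF indep_exp_weights prob_exp_weight_le]) auto
    finally show "prob {x\<in>space ?N. \<not> linked_rows s (s * q) v (light_edges n \<eta> x) y} \<le> ?r"
      by (simp add: card_cartesian_product)
  qed
  also have "\<dots> = real (card ?A) * ?r" by simp
  also have "\<dots> \<le> real (n ^ n) * ?r"
    using card_arrays_le r by (intro mult_right_mono) (auto simp: of_nat_mono simp del: of_nat_power)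
  finally show ?thesis by simp
qed

lemma prob_low_degree:
  assumes "0 \<le> \<eta>" "u < n" "2 \<le> n"
  defines "p \<equiv> 1 - exp (- \<eta>)"
  shows "measure (exp_weight_law n) {x\<in>space (exp_weight_law n).
      real (card {w\<in>{..<n}. {u, w} \<in> light_edges n \<eta> x}) \<le> (real n - 1) * p / 2}
    \<le> exp (- (real n - 1) * p\<^sup>2 / 2)"
proof -
  interpret prob_space "exp_weight_law n" by (rule prob_space_exp_weight_law)
  let ?N = "exp_weight_law n" and ?E = "edges (complete_graph n)"
  define I where "I = {..<n} - {u}"
  have I: "finite I" "real (card I) = real n - 1" using assms by (auto simp: I_def of_nat_diff)
  have eE: "{u, w} \<in> ?E" if "w \<in> I" for w
    using that assms(2) by (auto simp: complete_graph_def I_def)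
  define J where "J = (\<lambda>w. {u, w}) ` I"
  have JE: "J \<subseteq> ?E" using eE by (auto simp: J_def)
  have inj: "inj_on (\<lambda>w. {u, w}) I" by (auto simp: inj_on_def doubleton_eq_iff I_def)
  have J: "finite J" "real (card J) = real n - 1" using I inj by (auto simp: J_def card_image)
  define Y where "Y = (\<lambda>e (x :: nat set \<Rightarrow> real). indicator {..\<eta>} (x e) :: real)"
  have ind: "indep_vars (\<lambda>_. borel) Y J"
    unfolding Y_def
    by (rule indep_vars_compose2[where M' = "\<lambda>_. borel", OF indep_vars_subset[OF indep_exp_weights JE]]) auto
  interpret Hoeffding_ineq ?N J Y "\<lambda>_. 0" "\<lambda>_. 1" "real (card J) * p"
  proof unfold_locales
    have "expectation (Y e) = p" if "e \<in> J" for e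
    proof -
      have e: "e \<in> ?E" using that JE by auto
      have "expectation (Y e) = expectation (indicator {x\<in>space ?N. x e \<le> \<eta>})"
        unfolding Y_def by (intro Bochner_Integration.integral_cong) (auto simp: indicator_def)
      also have "\<dots> = p" using prob_exp_weight_le[OF e assms(1)] e by (simp add: p_def)
      finally show ?thesis .
    qed
    then show "real (card J) * p \<equiv> (\<Sum>e\<in>J. expectation (Y e))" by simp
  qed (use J ind in \<open>auto simp: Y_def indicator_def\<close>)
  have sub: "{x\<in>space ?N. real (card {w\<in>{..<n}. {u, w} \<in> light_edges n \<eta> x}) \<le> (real n - 1) * p / 2} =
    {x\<in>space ?N. (\<Sum>e\<in>J. Y e x) \<le> real (card J) * p - (real n - 1) * p / 2}"
  proof -
    have "(\<Sum>e\<in>J. Y e x) = real (card {w\<in>{..<n}. {u, w} \<in> light_edges n \<eta> x})" for x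
    proof -
      have "(\<Sum>e\<in>J. Y e x) = (\<Sum>w\<in>I. Y {u, w} x)"
        unfolding J_def using inj by (simp add: sum.reindex)
      also have "\<dots> = real (card {w\<in>I. x {u, w} \<le> \<eta>})"
        unfolding Y_def using I(1) by (simp add: indicator_def sum.If_cases Int_def)
      also have "{w\<in>I. x {u, w} \<le> \<eta>} = {w\<in>{..<n}. {u, w} \<in> light_edges n \<eta> x}"
        using assms(2) by (auto simp: I_def light_edges_def complete_graph_def card_insert_if)
      finally show ?thesis .
    qed
    moreover have "real (card J) * p - (real n - 1) * p / 2 = (real n - 1) * p / 2"
      by (simp add: J(2))
    ultimately show ?thesis by (simp only:)
  qed
  have p0: "0 \<le> p" using assms by (simp add: p_def)
  have "prob {x\<in>space ?N. (\<Sum>e\<in>J. Y e x) \<le> real (card J) * p - (real n - 1) * p / 2} \<le>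
     exp (- 2 * ((real n - 1) * p / 2)\<^sup>2 / (\<Sum>e\<in>J. (1 - 0)\<^sup>2))"
    using p0 assms(3) by (intro Hoeffding_ineq_le) (auto simp: J(2))
  also have "- 2 * ((real n - 1) * p / 2)\<^sup>2 / (\<Sum>e\<in>J. (1 - 0)\<^sup>2) = - (real n - 1) * p\<^sup>2 / 2"
    using assms(3) by (simp add: J(2) power2_eq_square field_simps)
  finally show ?thesis unfolding sub .
qed

lemma not_robust_cases:
  assumes v: "2 \<le> v" and "\<not> robust n v \<tau> S" "\<tau> = s * (s * q) * v" "s = v * (v - 1)"
  shows "(\<exists>u<n. card {w\<in>{..<n}. {u, w} \<in> S} < 4 * \<tau>) \<or>
    (\<exists>y\<in>arrays s (s * q) v n. \<not> linked_rows s (s * q) v S y)"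
proof (rule ccontr)
  assume "\<not> ?thesis"
  then have deg: "\<And>u. u < n \<Longrightarrow> 4 * \<tau> \<le> card {w\<in>{..<n}. {u, w} \<in> S}"
    and lr: "\<And>y. y \<in> arrays s (s * q) v n \<Longrightarrow> linked_rows s (s * q) v S y"
    by (meson not_less)+
  have "v * 1 \<le> v * (v - 1)" using v by (intro mult_le_mono2) simp
  then have vs: "v \<le> s" using assms(4) by simp
  have "absorbing n v \<tau> S"
    by (rule absorbing_if_linked_rows[where L = "s * q"]) (use lr assms in auto)
  moreover have "\<forall>W\<subseteq>{..<n}. \<tau> \<le> card W \<longrightarrow> (\<exists>T\<subseteq>W. card T = v \<and> clique_in S T)"
    using clique_in_dense[OF lr vs] v assms(3) by simp
  ultimately show False using assms(2) deg by (auto simp: robust_def)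
qed

text \<open>The array has \<open>s\<close> blocks of \<open>s * q\<close> rows with \<open>q = n div D\<close>. The constant \<open>D\<close> is taken so large
  that four times \<open>\<tau> = s * (s * q) * v\<close>, the number of entries, is at most half the expected
  degree; both failure probabilities, \<open>n * exp (- \<Omega>(n))\<close> for the degrees and \<open>n ^ n * exp (- \<Omega>(n\<^sup>2))\<close> for the
  arrays, then tend to 0.\<close>

lemma robust_whp:
  assumes "0 < \<eta>" "2 \<le> v"
  obtains \<rho> \<tau> where "0 < \<rho>" "\<forall>\<^sub>F n in sequentially. \<rho> * real n \<le> real (\<tau> n)"
    "((\<lambda>n. measure (exp_weight_law n)
        {x\<in>space (exp_weight_law n). \<not> robust n v (\<tau> n) (light_edges n \<eta> x)}) \<longlonglongrightarrow> 0)"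
proof -
  define s where "s = v * (v - 1)"
  define p where "p = 1 - exp (- \<eta>)"
  define K where "K = s * s * v"
  define r where "r = 1 - p ^ K"
  have s: "0 < s" using assms by (simp add: s_def)
  have K: "0 < K" using s assms by (simp add: K_def)
  have p: "0 < p" "p < 1" using assms by (auto simp: p_def)
  have r: "0 < r" "r < 1" using p K by (auto simp: r_def power_less_one_iff)
  obtain D :: nat where D: "16 * real K / p < real D" using reals_Archimedean2 by blast
  have D0: "0 < D" using D p K by (metis divide_nonneg_pos mult_nonneg_nonneg of_nat_0 of_nat_0_le_iff
        not_less zero_le_numeral gr0I)
  define \<tau> where "\<tau> n = K * (n div D)" for n
  let ?bad = "\<lambda>n. measure (exp_weight_law n)
     {x\<in>space (exp_weight_law n). \<not> robust n v (\<tau> n) (light_edges n \<eta> x)}"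
  have "?bad n \<le> real n * exp (- (real n - 1) * p\<^sup>2 / 2) + real n ^ n * r ^ ((n div D) * (n div D))"
    if n: "2 \<le> n" for n
  proof -
    interpret prob_space "exp_weight_law n" by (rule prob_space_exp_weight_law)
    let ?N = "exp_weight_law n" and ?q = "n div D"
    define L where "L u = {x\<in>space ?N. real (card {w\<in>{..<n}. {u, w} \<in> light_edges n \<eta> x}) \<le> (real n - 1) * p / 2}" for u
    define A where "A = {x\<in>space ?N. \<exists>y\<in>arrays s (s * ?q) v n. \<not> linked_rows s (s * ?q) v (light_edges n \<eta> x) y}"
    have "4 * real (\<tau> n) \<le> (real n - 1) * p / 2"
    proof -
      have "real (n div D) * real D \<le> real n"
        by (metis of_nat_mult of_nat_mono div_times_less_eq_dividend)
      moreover have "16 * real K < p * real D" using D p by (simp add: field_simps)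
      then have "16 * real K * real (n div D) \<le> p * real D * real (n div D)"
        by (intro mult_right_mono) auto
      ultimately have "16 * real K * real (n div D) \<le> p * real n"
        using p by (smt (verit) mult.commute mult.left_commute mult_left_mono)
      moreover have "p * real n \<le> p * (2 * (real n - 1))" using n p by (intro mult_left_mono) auto
      ultimately show ?thesis by (simp add: \<tau>_def algebra_simps)
    qed
    then have deg: "real (card {w\<in>{..<n}. {u, w} \<in> S}) \<le> (real n - 1) * p / 2"
      if "card {w\<in>{..<n}. {u, w} \<in> S} < 4 * \<tau> n" for u S
      using that by linarith
    have sub: "{x\<in>space ?N. \<not> robust n v (\<tau> n) (light_edges n \<eta> x)} \<subseteq> (\<Union>u<n. L u) \<union> A"
    proof
      fix x assume x: "x \<in> {x\<in>space ?N. \<not> robust n v (\<tau> n) (light_edges n \<eta> x)}"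
      have "\<tau> n = s * (s * ?q) * v" by (simp add: \<tau>_def K_def)
      with not_robust_cases[OF assms(2), of n "\<tau> n" "light_edges n \<eta> x" s ?q] x
      have "(\<exists>u<n. card {w\<in>{..<n}. {u, w} \<in> light_edges n \<eta> x} < 4 * \<tau> n) \<or>
        (\<exists>y\<in>arrays s (s * ?q) v n. \<not> linked_rows s (s * ?q) v (light_edges n \<eta> x) y)"
        by (simp add: s_def)
      then show "x \<in> (\<Union>u<n. L u) \<union> A"
        using x deg[of _ "light_edges n \<eta> x"] unfolding L_def A_def by blast
    qed
    have L: "L u \<in> events" for u
      unfolding L_def
      by (rule light_edges_event[of n "\<lambda>S. real (card {w\<in>{..<n}. {u, w} \<in> S}) \<le> (real n - 1) * p / 2"])
    have A: "A \<in> events"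
      unfolding A_def
      by (rule light_edges_event)
    have "?bad n \<le> prob ((\<Union>u<n. L u) \<union> A)"
      using L A by (intro finite_measure_mono[OF sub] sets.Un sets.finite_UN) auto
    also have "\<dots> \<le> prob (\<Union>u<n. L u) + prob A"
      using L A by (intro measure_Un_le sets.finite_UN) auto
    also have "prob (\<Union>u<n. L u) \<le> (\<Sum>u<n. prob (L u))"
      using L by (intro finite_measure_subadditive_finite) auto
    also have "\<dots> \<le> (\<Sum>u<n. exp (- (real n - 1) * p\<^sup>2 / 2))"
    proof (rule sum_mono)
      fix u assume "u \<in> {..<n}"
      then show "prob (L u) \<le> exp (- (real n - 1) * p\<^sup>2 / 2)"
        using prob_low_degree[of \<eta> u n] assms n unfolding L_def p_def by simp
    qed
    also have "prob A \<le> real n ^ n * r ^ (?q * ?q)"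
      using prob_not_linked[of \<eta> n s ?q v] assms by (simp add: r_def p_def K_def A_def)
    finally show ?thesis by simp
  qed
  then have le: "\<forall>\<^sub>F n in sequentially. ?bad n \<le>
      real n * exp (- (real n - 1) * p\<^sup>2 / 2) + real n ^ n * r ^ ((n div D) * (n div D))"
    by (intro eventually_sequentiallyI[of 2]) auto
  have divD: "real n / real D - 1 \<le> real (n div D)" for n
  proof -
    have "real n < (real (n div D) + 1) * real D"
      using D0 dividend_less_times_div[of D n] by (metis add.commute mult.commute of_nat_Suc of_nat_less_iff of_nat_mult mult_Suc_right)
    then show ?thesis using D0 by (simp add: field_simps)
  qed
  have lim: "(\<lambda>n. real n * exp (- (real n - 1) * p\<^sup>2 / 2) + real n ^ n * r ^ ((n div D) * (n div D))) \<longlonglongrightarrow> 0"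
  proof (intro tendsto_add_zero)
    show "(\<lambda>n. real n * exp (- (real n - 1) * p\<^sup>2 / 2)) \<longlonglongrightarrow> 0"
      using p by real_asymp
    define c where "c = - ln r"
    have c: "0 < c" using r by (simp add: c_def)
    define d where "d = real D"
    have d: "0 < d" using D0 by (simp add: d_def)
    have "\<forall>\<^sub>F n in sequentially. real n ^ n * r ^ ((n div D) * (n div D)) \<le>
       exp (real n * ln (real n) - c * (real n / d - 1)\<^sup>2)"
    proof (rule eventually_sequentiallyI[of "max 1 D"])
      fix n assume "max 1 D \<le> n"
      then have n: "1 \<le> n" "D \<le> n" by auto
      have "real n / d - 1 \<ge> 0" using n d by (simp add: d_def)
      then have "(real n / d - 1)\<^sup>2 \<le> (real (n div D))\<^sup>2" using divD[of n] by (intro power_mono) (auto simp: d_def)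
      then have "c * (real n / d - 1)\<^sup>2 \<le> c * (real (n div D))\<^sup>2" using c by simp
      moreover have "real n ^ n = exp (real n * ln (real n))" using n by (simp add: exp_of_nat_mult)
      moreover have "r ^ ((n div D) * (n div D)) = exp (real ((n div D) * (n div D)) * ln r)"
        using r by (simp only: exp_of_nat_mult exp_ln)
      moreover have "real ((n div D) * (n div D)) * ln r = - c * (real (n div D))\<^sup>2"
        by (simp add: c_def power2_eq_square)
      ultimately show "real n ^ n * r ^ ((n div D) * (n div D)) \<le>
          exp (real n * ln (real n) - c * (real n / d - 1)\<^sup>2)"
        by (simp add: exp_add[symmetric])
    qed
    moreover have "(\<lambda>n. exp (real n * ln (real n) - c * (real n / d - 1)\<^sup>2)) \<longlonglongrightarrow> 0"
      using c d by real_asymp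
    ultimately show "(\<lambda>n. real n ^ n * r ^ ((n div D) * (n div D))) \<longlonglongrightarrow> 0"
      by (rule tendsto_sandwich[OF _ _ tendsto_const, rotated]) (use r in auto)
  qed
  have "?bad \<longlonglongrightarrow> 0"
    by (rule tendsto_sandwich[OF _ le tendsto_const lim]) simp
  moreover have "\<forall>\<^sub>F n in sequentially. (K / (2 * real D)) * real n \<le> real (\<tau> n)"
  proof (rule eventually_sequentiallyI[of "2 * D"])
    fix n assume "2 * D \<le> n"
    then have "real n / (2 * real D) \<le> real n / real D - 1" using D0 by (simp add: field_simps)
    also have "\<dots> \<le> real (n div D)" by (rule divD)
    finally have "K * (real n / (2 * real D)) \<le> K * real (n div D)" by (intro mult_left_mono) auto
    then show "(K / (2 * real D)) * real n \<le> real (\<tau> n)" by (simp add: \<tau>_def)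
  qed
  moreover have "0 < K / (2 * real D)" using K D0 by simp
  ultimately show ?thesis using that by blast
qed

section \<open>Rearranging factors and covers\<close>

lemma edge_complete_iff: "e \<in> edges (complete_graph n) \<longleftrightarrow> e \<subseteq> {..<n} \<and> card e = 2"
  by (simp add: complete_graph_def)

lemma verts_complete [simp]: "verts (complete_graph n) = {..<n}"
  by (simp add: complete_graph_def)

lemma clique_in_complete: "T \<subseteq> {..<n} \<Longrightarrow> clique_in (edges (complete_graph n)) T"
  by (auto simp: clique_in_def edge_complete_iff)

definition is_copy :: "'a graph \<Rightarrow> nat \<Rightarrow> nat graph \<Rightarrow> bool" where
  "is_copy H n K \<longleftrightarrow> subgraph K (complete_graph n) \<and> graph_isomorphic H K"

lemma is_copy_edges: "is_copy H n K \<Longrightarrow> edges K \<subseteq> edges (complete_graph n)"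
  by (simp add: is_copy_def subgraph_def)

definition covered :: "nat graph set \<Rightarrow> nat set" where
  "covered Q = (\<Union>K\<in>Q. verts K)"

lemma H_cover_iff:
  "H_cover H \<alpha> n Q \<longleftrightarrow> (\<forall>K\<in>Q. is_copy H n K) \<and> real (card ({..<n} - covered Q)) \<le> \<alpha> * real n"
  by (simp add: H_cover_def is_copy_def covered_def)

lemma finite_subgraphs: "finite {K. subgraph K (complete_graph n)}"
proof (rule finite_subset)
  show "{K. subgraph K (complete_graph n)} \<subseteq> Pow {..<n} \<times> Pow (edges (complete_graph n))"
    by (auto simp: subgraph_def)
qed simp

lemma finite_copies: "\<forall>K\<in>Q. is_copy H n K \<Longrightarrow> finite Q"
  by (rule finite_subset[OF _ finite_subgraphs[of n]]) (auto simp: is_copy_def)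

lemma finite_covers: "finite {Q. H_cover H \<alpha> n Q}"
proof (rule finite_subset)
  show "{Q. H_cover H \<alpha> n Q} \<subseteq> Pow {K. subgraph K (complete_graph n)}"
    by (auto simp: H_cover_def)
qed (use finite_subgraphs in simp)

lemma finite_factors: "finite {Q. H_factor H \<alpha> n Q}"
  by (rule finite_subset[OF _ finite_covers]) (auto simp: H_factor_def)

lemma min_factor_weight_le:
  "H_factor H (m / real n) n Q \<Longrightarrow> min_factor_weight H m n w \<le> total_weight w Q"
  unfolding min_factor_weight_def by (intro Min_le finite_imageI finite_factors imageI CollectI)

lemma min_cover_weight_le:
  "H_cover H (m / real n) n Q \<Longrightarrow> min_cover_weight H m n w \<le> total_weight w Q"
  unfolding min_cover_weight_def by (intro Min_le finite_imageI finite_covers imageI CollectI)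

lemma min_factor_weight_attained:
  assumes "H_factor H (m / real n) n Q0"
  shows "\<exists>Q. H_factor H (m / real n) n Q \<and> min_factor_weight H m n w = total_weight w Q"
proof -
  have "min_factor_weight H m n w \<in> total_weight w ` {Q. H_factor H (m / real n) n Q}"
    unfolding min_factor_weight_def
    by (rule Min_in[OF finite_imageI[OF finite_factors]]) (use assms in blast)
  then show ?thesis by blast
qed

lemma min_cover_weight_attained:
  assumes "H_cover H (m / real n) n Q0"
  shows "\<exists>Q. H_cover H (m / real n) n Q \<and> min_cover_weight H m n w = total_weight w Q"
proof -
  have "min_cover_weight H m n w \<in> total_weight w ` {Q. H_cover H (m / real n) n Q}"
    unfolding min_cover_weight_def
    by (rule Min_in[OF finite_imageI[OF finite_covers]]) (use assms in blast)
  then show ?thesis by blast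
qed

lemma total_weight_nonneg:
  assumes "\<And>e. e \<in> edges (complete_graph n) \<Longrightarrow> 0 \<le> w e" "\<forall>K\<in>Q. is_copy H n K"
  shows "0 \<le> total_weight w Q"
  unfolding total_weight_def
proof (intro sum_nonneg)
  fix K e assume "K \<in> Q" "e \<in> edges K"
  then show "0 \<le> w e" using assms is_copy_edges by blast
qed

lemma total_weight_mono:
  assumes "\<And>e. e \<in> edges (complete_graph n) \<Longrightarrow> 0 \<le> w e" "\<forall>K\<in>Q'. is_copy H n K" "Q \<subseteq> Q'"
  shows "total_weight w Q \<le> total_weight w Q'"
  unfolding total_weight_def
proof (rule sum_mono2)
  fix K assume "K \<in> Q' - Q"
  then have "edges K \<subseteq> edges (complete_graph n)" using assms(2) is_copy_edges by blast
  then show "0 \<le> (\<Sum>e\<in>edges K. w e)" using assms(1) by (intro sum_nonneg) blast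
qed (use assms(3) finite_copies[OF assms(2)] in simp_all)

lemma total_weight_Un_le:
  assumes "\<And>e. e \<in> edges (complete_graph n) \<Longrightarrow> 0 \<le> w e" "\<forall>K\<in>Q \<union> Q'. is_copy H n K"
  shows "total_weight w (Q \<union> Q') \<le> total_weight w Q + total_weight w Q'"
proof -
  have fin: "finite Q" "finite Q'" using assms(2) finite_copies[of Q H n] finite_copies[of Q' H n] by auto
  have "0 \<le> total_weight w (Q \<inter> Q')" using assms by (intro total_weight_nonneg[of n w _ H]) auto
  then show ?thesis
    unfolding total_weight_def using sum.union_inter[OF fin, of "\<lambda>K. \<Sum>e\<in>edges K. w e"] by linarith
qed

lemma total_weight_split:
  assumes "finite Q" "B \<subseteq> Q"
  shows "total_weight w Q = total_weight w (Q - B) + total_weight w B"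
  unfolding total_weight_def by (rule sum.subset_diff[OF assms(2,1)])

locale fixed_graph =
  fixes H :: "'a graph"
  assumes simple: "finite_simple_graph H" and nonempty: "edges H \<noteq> {}"
begin

abbreviation v :: nat where "v \<equiv> card (verts H)"
abbreviation eH :: nat where "eH \<equiv> card (edges H)"

lemma finite_verts: "finite (verts H)" using simple by (simp add: finite_simple_graph_def)

lemma finite_edges: "finite (edges H)"
  by (rule finite_subset[of _ "Pow (verts H)"])
    (use simple finite_verts in \<open>auto simp: finite_simple_graph_def\<close>)

lemma v_ge_2: "2 \<le> v"
proof -
  obtain e where e: "e \<in> edges H" using nonempty by auto
  then have "e \<subseteq> verts H" "card e = 2" using simple by (auto simp: finite_simple_graph_def)
  then show ?thesis using card_mono[OF finite_verts] by metis
qed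

lemma eH_pos: "0 < eH" using nonempty finite_edges by (simp add: card_gt_0_iff)

lemma copyD:
  assumes "is_copy H n K"
  shows "card (verts K) = v" "verts K \<subseteq> {..<n}" "verts K \<noteq> {}" "edges K \<subseteq> edges (complete_graph n)"
    "finite (edges K)" "edges K \<noteq> {}" "card (edges K) \<le> eH"
proof -
  obtain f where f: "bij_betw f (verts H) (verts K)" "edges K = (\<lambda>e. f ` e) ` edges H"
    using assms by (auto simp: is_copy_def graph_isomorphic_def)
  show c: "card (verts K) = v" using bij_betw_same_card[OF f(1)] by simp
  show "verts K \<noteq> {}" using c v_ge_2 by auto
  show "verts K \<subseteq> {..<n}" "edges K \<subseteq> edges (complete_graph n)"
    using assms by (auto simp: is_copy_def subgraph_def)
  show "finite (edges K)" "edges K \<noteq> {}" using f(2) finite_edges nonempty by auto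
  show "card (edges K) \<le> eH" unfolding f(2) by (rule card_image_le[OF finite_edges])
qed

lemma copy_on_clique:
  assumes "T \<subseteq> {..<n}" "card T = v" "clique_in S T"
  shows "\<exists>K. is_copy H n K \<and> verts K = T \<and> edges K \<subseteq> S"
proof -
  have "finite T" using assms(1) finite_subset by blast
  then obtain f where f: "bij_betw f (verts H) T"
    using finite_same_card_bij[OF finite_verts] assms(2) by metis
  let ?K = "(T, (\<lambda>e. f ` e) ` edges H)"
  have edge: "f ` e \<in> S \<and> f ` e \<subseteq> T \<and> card (f ` e) = 2" if "e \<in> edges H" for e
  proof -
    have e: "e \<subseteq> verts H" "card e = 2" using simple that by (auto simp: finite_simple_graph_def)
    then obtain a b where ab: "e = {a, b}" "a \<noteq> b" by (auto simp: card_2_iff)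
    have "f a \<noteq> f b" "f a \<in> T" "f b \<in> T" using f e ab by (auto simp: bij_betw_def inj_on_def)
    then show ?thesis using assms(3) by (auto simp: ab clique_in_def)
  qed
  have "edges ?K \<subseteq> edges (complete_graph n)"
  proof
    fix e' assume "e' \<in> edges ?K"
    then obtain e where "e \<in> edges H" "e' = f ` e" by auto
    then have "e' \<subseteq> T" "card e' = 2" using edge by auto
    then show "e' \<in> edges (complete_graph n)" using assms(1) unfolding edge_complete_iff by blast
  qed
  then have "is_copy H n ?K"
    unfolding is_copy_def subgraph_def graph_isomorphic_def
    using f edge assms(1) by auto
  then show ?thesis using edge by (intro exI[of _ ?K]) auto
qed

lemma card_covered:
  assumes "\<forall>K\<in>Q. is_copy H n K" "disjoint_family_on verts Q"
  shows "card (covered Q) = v * card Q"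
proof -
  have "card (covered Q) = (\<Sum>K\<in>Q. card (verts K))"
    unfolding covered_def
  proof (rule card_UN_disjoint)
    show "finite Q" using finite_copies[OF assms(1)] .
    show "\<forall>K\<in>Q. finite (verts K)" using assms(1) finite_subset[OF copyD(2) finite_lessThan] by blast
  qed (use assms(2) in \<open>unfold disjoint_family_on_def, blast\<close>)
  also have "\<dots> = (\<Sum>K\<in>Q. v)" using assms(1) copyD(1) by (intro sum.cong) blast+
  also have "\<dots> = v * card Q" by simp
  finally show ?thesis .
qed

lemma covered_sub: "\<forall>K\<in>Q. is_copy H n K \<Longrightarrow> covered Q \<subseteq> {..<n}"
  using copyD(2) by (fastforce simp: covered_def)

lemma total_weight_le_card:
  assumes "\<forall>K\<in>Q. is_copy H n K \<and> edges K \<subseteq> S" "\<And>e. e \<in> S \<Longrightarrow> w e \<le> \<beta>" "0 \<le> \<beta>"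
  shows "total_weight w Q \<le> real (card Q) * (real eH * \<beta>)"
proof -
  have "(\<Sum>e\<in>edges K. w e) \<le> real eH * \<beta>" if "K \<in> Q" for K
  proof -
    have "(\<Sum>e\<in>edges K. w e) \<le> (\<Sum>e\<in>edges K. \<beta>)" using assms that by (intro sum_mono) auto
    also have "\<dots> = real (card (edges K)) * \<beta>" by simp
    also have "\<dots> \<le> real eH * \<beta>"
    proof -
      have "is_copy H n K" using assms(1) that by blast
      from copyD(7)[OF this] show ?thesis using assms(3) by (intro mult_right_mono) auto
    qed
    finally show ?thesis .
  qed
  then show ?thesis unfolding total_weight_def by (rule sum_bounded_above)
qed

text \<open>One member \<open>b\<close> of the set \<open>B\<close> of heavy copies is removed. If at least \<open>\<tau>\<close> vertices are
  uncovered, they contain a light clique that can replace \<open>b\<close>, so that the covered set changes but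
  not its size. Otherwise every vertex has many light neighbours in members outside \<open>B\<close>, and the
  exchange property applies.\<close>

lemma repair_one:
  assumes rob: "robust n v \<tau> S"
    and w: "\<And>e. e \<in> edges (complete_graph n) \<Longrightarrow> 0 \<le> w e"
    and \<beta>: "\<And>e. e \<in> S \<Longrightarrow> w e \<le> \<beta>" "0 \<le> \<beta>"
    and Q: "\<forall>K\<in>Q. is_copy H n K" "disjoint_family_on verts Q"
    and b: "b \<in> B" and B: "B \<subseteq> Q" "v * card B \<le> \<tau>"
    and good: "\<forall>K\<in>Q - B. edges K \<subseteq> L" and SL: "S \<subseteq> L"
  obtains Q' where "\<forall>K\<in>Q'. is_copy H n K" "disjoint_family_on verts Q'" "B - {b} \<subseteq> Q'"
    "\<forall>K\<in>Q' - (B - {b}). edges K \<subseteq> L" "card (covered Q') = card (covered Q)"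
    "total_weight w (Q' - (B - {b})) \<le> total_weight w (Q - B) + real (v\<^sup>2) * (real eH * \<beta>)"
proof -
  define W where "W = {..<n} - covered Q"
  have fQ: "finite Q" using Q finite_copies by blast
  have vpos: "0 < v" using v_ge_2 by simp
  have bQ: "b \<in> Q" using b B by blast
  have dis: "verts K \<inter> verts K' = {}" if "K \<in> Q" "K' \<in> Q" "K \<noteq> K'" for K K'
    using Q(2) that by (auto simp: disjoint_family_on_def)
  have eb: "0 \<le> real eH * \<beta>" using \<beta>(2) by simp
  show thesis
  proof (cases "\<tau> \<le> card W")
    case True
    moreover have "W \<subseteq> {..<n}" by (auto simp: W_def)
    ultimately obtain T where T: "T \<subseteq> W" "card T = v" "clique_in S T"
      using rob unfolding robust_def by blast
    then obtain K where K: "is_copy H n K" "verts K = T" "edges K \<subseteq> S"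
      using copy_on_clique[of T n S] \<open>W \<subseteq> {..<n}\<close> by blast
    have TQ: "T \<inter> verts K' = {}" if "K' \<in> Q" for K' using T(1) that by (auto simp: W_def covered_def)
    define Q' where "Q' = insert K (Q - {b})"
    have copies: "\<forall>K\<in>Q'. is_copy H n K" using Q K by (auto simp: Q'_def)
    have disj: "disjoint_family_on verts Q'"
      using TQ dis K(2) unfolding disjoint_family_on_def Q'_def by (auto simp: Int_commute)
    have KQ: "K \<notin> Q" using TQ[of K] K copyD(3) by blast
    have "card Q' = card Q" using KQ fQ card_Suc_Diff1[OF fQ bQ] by (simp add: Q'_def)
    then have card: "card (covered Q') = card (covered Q)"
      using card_covered[OF copies disj] card_covered[OF Q] by simp
    have sub: "Q' - (B - {b}) \<subseteq> (Q - B) \<union> {K}" using b by (auto simp: Q'_def)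
    have "total_weight w (Q' - (B - {b})) \<le> total_weight w ((Q - B) \<union> {K})"
      by (rule total_weight_mono[OF w _ sub]) (use Q K in auto)
    also have "\<dots> \<le> total_weight w (Q - B) + total_weight w {K}"
      by (rule total_weight_Un_le[OF w]) (use Q K in auto)
    also have "total_weight w {K} \<le> real (card {K}) * (real eH * \<beta>)"
      by (rule total_weight_le_card[of _ n S]) (use K \<beta> in auto)
    also have "\<dots> \<le> real (v\<^sup>2) * (real eH * \<beta>)"
      using eb vpos by (intro mult_right_mono) (auto simp: Suc_le_eq)
    finally have "total_weight w (Q' - (B - {b})) \<le> total_weight w (Q - B) + real (v\<^sup>2) * (real eH * \<beta>)"
      by simp
    moreover have "\<forall>K\<in>Q' - (B - {b}). edges K \<subseteq> L" using sub good K(3) SL by blast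
    moreover have "B - {b} \<subseteq> Q'" using B by (auto simp: Q'_def)
    ultimately show thesis using copies disj card by - (rule that)
  next
    case False
    then have Wless: "card W < \<tau>" by simp
    define R where "R = verts ` (Q - B)"
    have copB: "\<forall>K\<in>B. is_copy H n K" "disjoint_family_on verts B"
      using Q B(1) unfolding disjoint_family_on_def by blast+
    have covB: "card (covered B) \<le> \<tau>" using card_covered[OF copB] B by simp
    have UR: "\<Union>R = covered (Q - B)" by (simp add: R_def covered_def)
    have univ: "{..<n} \<subseteq> W \<union> covered B \<union> \<Union>R"
      unfolding UR by (auto simp: W_def covered_def)
    have deg: "\<tau> \<le> card ({w. {u, w} \<in> S} \<inter> \<Union>R)" if "u < n" for u
    proof -
      have fin: "finite W" "finite (covered B)" "finite ({w. {u, w} \<in> S} \<inter> \<Union>R)"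
        using finite_subset[OF covered_sub[OF copB(1)]] finite_subset[OF covered_sub[of "Q - B" n]] Q
        by (auto simp: W_def UR)
      have "4 * \<tau> \<le> card {w\<in>{..<n}. {u, w} \<in> S}" using rob that by (auto simp: robust_def)
      also have "\<dots> \<le> card (W \<union> covered B \<union> ({w. {u, w} \<in> S} \<inter> \<Union>R))"
        using univ fin by (intro card_mono) auto
      also have "\<dots> \<le> card W + card (covered B) + card ({w. {u, w} \<in> S} \<inter> \<Union>R)"
        using card_Un_le[of "W \<union> covered B" "{w. {u, w} \<in> S} \<inter> \<Union>R"] card_Un_le[of W "covered B"]
        by linarith
      finally show ?thesis using Wless covB by linarith
    qed
    have cb: "is_copy H n b" using Q(1) bQ by blast
    have "absorbing n v \<tau> S" using rob by (simp add: robust_def)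
    moreover have "verts b \<subseteq> {..<n}" "card (verts b) = v" using copyD[OF cb] by auto
    moreover have "\<forall>r\<in>R. r \<subseteq> {..<n} \<and> card r = v \<and> r \<inter> verts b = {}"
    proof
      fix r assume "r \<in> R"
      then obtain K where K: "K \<in> Q - B" "r = verts K" by (auto simp: R_def)
      then have "K \<noteq> b" "K \<in> Q" using b by auto
      then show "r \<subseteq> {..<n} \<and> card r = v \<and> r \<inter> verts b = {}"
        using K(2) Q(1) copyD(1,2) dis[OF _ bQ] by blast
    qed
    moreover have "disjoint R" unfolding R_def disjoint_def using dis by blast
    moreover have "\<forall>u\<in>verts b. \<tau> \<le> card ({w. {u, w} \<in> S} \<inter> \<Union>R)"
      using deg copyD(2)[OF cb] by auto
    ultimately have "\<exists>R0\<subseteq>R. \<exists>T. card T \<le> v\<^sup>2 \<and> finite T \<and> disjoint T \<and>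
        (\<forall>t\<in>T. card t = v \<and> clique_in S t) \<and> \<Union>T = verts b \<union> \<Union>R0"
      unfolding absorbing_def by simp
    then obtain R0 T where R0: "R0 \<subseteq> R" and T: "card T \<le> v\<^sup>2" "finite T" "disjoint T"
      "\<forall>t\<in>T. card t = v \<and> clique_in S t" "\<Union>T = verts b \<union> \<Union>R0"
      by blast
    have Tn: "t \<subseteq> {..<n}" if "t \<in> T" for t
    proof -
      have "t \<subseteq> verts b \<union> \<Union>R" using that T(5) R0 by blast
      also have "\<dots> \<subseteq> {..<n}" using copyD(2)[OF cb] covered_sub[of "Q - B" n] Q(1) by (auto simp: UR)
      finally show ?thesis .
    qed
    have "\<forall>t\<in>T. \<exists>K. is_copy H n K \<and> verts K = t \<and> edges K \<subseteq> S"
      using copy_on_clique[OF Tn] T(4) by blast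
    then obtain c where c: "\<And>t. t \<in> T \<Longrightarrow> is_copy H n (c t) \<and> verts (c t) = t \<and> edges (c t) \<subseteq> S"
      by metis
    define Q0 where "Q0 = {K\<in>Q - B. verts K \<in> R0}"
    have R0Q0: "R0 = verts ` Q0" using R0 by (auto simp: R_def Q0_def)
    define Q' where "Q' = (Q - {b} - Q0) \<union> c ` T"
    have TK: "t \<inter> verts K = {}" if "t \<in> T" "K \<in> Q - {b} - Q0" for t K
    proof -
      have "t \<subseteq> verts b \<union> \<Union>(verts ` Q0)" using that T(5) R0Q0 by blast
      moreover have "verts b \<inter> verts K = {}" using dis[OF bQ, of K] that(2) by blast
      moreover have "verts K' \<inter> verts K = {}" if "K' \<in> Q0" for K'
        using dis[of K' K] that \<open>K \<in> Q - {b} - Q0\<close> unfolding Q0_def by blast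
      ultimately show ?thesis by blast
    qed
    have copies: "\<forall>K\<in>Q'. is_copy H n K" using Q c by (auto simp: Q'_def)
    have disj: "disjoint_family_on verts Q'"
      unfolding disjoint_family_on_def
    proof (intro ballI impI)
      fix K K' assume K: "K \<in> Q'" "K' \<in> Q'" "K \<noteq> K'"
      consider "K \<in> Q - {b} - Q0" "K' \<in> Q - {b} - Q0"
        | t where "t \<in> T" "K = c t" "K' \<in> Q - {b} - Q0"
        | t where "t \<in> T" "K' = c t" "K \<in> Q - {b} - Q0"
        | t t' where "t \<in> T" "t' \<in> T" "K = c t" "K' = c t'"
        using K unfolding Q'_def by blast
      then show "verts K \<inter> verts K' = {}"
      proof cases
        case 1
        then show ?thesis using dis K(3) by blast
      next
        case 2
        then show ?thesis using TK c by metis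
      next
        case 3
        then show ?thesis using TK c by (metis Int_commute)
      next
        case 4
        then have "t \<noteq> t'" using K(3) by blast
        then have "t \<inter> t' = {}" using T(3) 4 unfolding disjoint_def by blast
        then show ?thesis using c 4 by metis
      qed
    qed
    have "covered Q' = covered Q"
    proof -
      have "covered Q' = covered (Q - {b} - Q0) \<union> \<Union>T" using c by (auto simp: Q'_def covered_def)
      also have "\<dots> = covered (Q - {b} - Q0) \<union> (verts b \<union> covered Q0)"
        unfolding T(5) R0Q0 by (simp add: covered_def)
      also have "\<dots> = covered Q" using bQ by (auto simp: covered_def Q0_def)
      finally show ?thesis .
    qed
    then have card: "card (covered Q') = card (covered Q)" by simp
    have sub: "Q' - (B - {b}) \<subseteq> (Q - B) \<union> c ` T" by (auto simp: Q'_def)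
    have "total_weight w (Q' - (B - {b})) \<le> total_weight w ((Q - B) \<union> c ` T)"
      by (rule total_weight_mono[OF w _ sub]) (use Q c in auto)
    also have "\<dots> \<le> total_weight w (Q - B) + total_weight w (c ` T)"
      by (rule total_weight_Un_le[OF w]) (use Q c in auto)
    also have "total_weight w (c ` T) \<le> real (card (c ` T)) * (real eH * \<beta>)"
      by (rule total_weight_le_card[of _ n S]) (use c \<beta> in auto)
    also have "\<dots> \<le> real (v\<^sup>2) * (real eH * \<beta>)"
      using eb card_image_le[OF T(2), of c] T(1) by (intro mult_right_mono of_nat_mono) auto
    finally have "total_weight w (Q' - (B - {b})) \<le> total_weight w (Q - B) + real (v\<^sup>2) * (real eH * \<beta>)"
      by simp
    moreover have "\<forall>K\<in>Q' - (B - {b}). edges K \<subseteq> L" using sub good c SL by blast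
    moreover have "B - {b} \<subseteq> Q'" using B by (auto simp: Q'_def Q0_def)
    ultimately show thesis using copies disj card by - (rule that)
  qed
qed

lemma repair:
  assumes rob: "robust n v \<tau> S"
    and w: "\<And>e. e \<in> edges (complete_graph n) \<Longrightarrow> 0 \<le> w e"
    and \<beta>: "\<And>e. e \<in> S \<Longrightarrow> w e \<le> \<beta>" "0 \<le> \<beta>" and SL: "S \<subseteq> L"
    and Q: "\<forall>K\<in>Q. is_copy H n K" "disjoint_family_on verts Q"
    and B: "B \<subseteq> Q" "v * card B \<le> \<tau>" and good: "\<forall>K\<in>Q - B. edges K \<subseteq> L"
  shows "\<exists>Q'. (\<forall>K\<in>Q'. is_copy H n K \<and> edges K \<subseteq> L) \<and> disjoint_family_on verts Q' \<and>
    card (covered Q') = card (covered Q) \<and>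
    total_weight w Q' \<le> total_weight w (Q - B) + real (card B) * (real (v\<^sup>2) * (real eH * \<beta>))"
  using Q B good
proof (induction "card B" arbitrary: Q B)
  case 0
  then have "B = {}" using finite_copies[OF \<open>\<forall>K\<in>Q. is_copy H n K\<close>] finite_subset by fastforce
  then show ?case using 0 by (intro exI[of _ Q]) auto
next
  case (Suc k)
  then obtain b where b: "b \<in> B" by (metis card.empty ex_in_conv nat.distinct(1))
  have fB: "finite B" using Suc.hyps(2) by (metis card.infinite nat.distinct(1))
  obtain Q1 where Q1: "\<forall>K\<in>Q1. is_copy H n K" "disjoint_family_on verts Q1" "B - {b} \<subseteq> Q1"
    "\<forall>K\<in>Q1 - (B - {b}). edges K \<subseteq> L" "card (covered Q1) = card (covered Q)"
    "total_weight w (Q1 - (B - {b})) \<le> total_weight w (Q - B) + real (v\<^sup>2) * (real eH * \<beta>)"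
    by (rule repair_one[where w = w, OF rob w \<beta> Suc.prems(1,2) b Suc.prems(3,4,5) SL])
  have k: "k = card (B - {b})" using Suc.hyps(2) b fB by simp
  have "v * card (B - {b}) \<le> \<tau>"
    using Suc.prems(4) card_Diff1_le[of B b] by (meson le_trans mult_le_mono2)
  from Suc.hyps(1)[OF k Q1(1,2,3) this Q1(4)]
  obtain Q' where Q': "\<forall>K\<in>Q'. is_copy H n K \<and> edges K \<subseteq> L" "disjoint_family_on verts Q'"
    "card (covered Q') = card (covered Q1)"
    "total_weight w Q' \<le> total_weight w (Q1 - (B - {b})) + real (card (B - {b})) * (real (v\<^sup>2) * (real eH * \<beta>))"
    by blast
  have "real (card B) = real (card (B - {b})) + 1" using k Suc.hyps(2) by simp
  then have "total_weight w Q' \<le> total_weight w (Q - B) + real (card B) * (real (v\<^sup>2) * (real eH * \<beta>))"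
    using Q'(4) Q1(6) by (simp add: distrib_right)
  then show ?case using Q' Q1(5) by (intro exI[of _ Q']) auto
qed

lemma exists_partition_into_copies:
  assumes "W \<subseteq> {..<n}" "card W = k * v"
  shows "\<exists>Q. (\<forall>K\<in>Q. is_copy H n K) \<and> disjoint_family_on verts Q \<and> covered Q = W"
  using assms
proof (induction k arbitrary: W)
  case 0
  then have "W = {}" using finite_subset by fastforce
  then show ?case by (intro exI[of _ "{}"]) (auto simp: covered_def disjoint_family_on_def)
next
  case (Suc k)
  have fW: "finite W" using Suc.prems finite_subset by blast
  have "v \<le> card W" using Suc.prems by simp
  then obtain T where T: "T \<subseteq> W" "card T = v" by (meson obtain_subset_with_card_n)
  obtain K where K: "is_copy H n K" "verts K = T"
    using copy_on_clique[OF _ T(2) clique_in_complete] T(1) Suc.prems(1) by blast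
  have fT: "finite T" using T(1) fW finite_subset by blast
  have "W - T \<subseteq> {..<n}" using Suc.prems by auto
  moreover have "card (W - T) = k * v" using Suc.prems T fT by (simp add: card_Diff_subset)
  ultimately obtain Q where Q: "\<forall>K\<in>Q. is_copy H n K" "disjoint_family_on verts Q" "covered Q = W - T"
    using Suc.IH by meson
  have "disjoint_family_on verts (insert K Q)"
    using Q(2,3) K(2) unfolding disjoint_family_on_def covered_def by blast
  moreover have "covered (insert K Q) = W" using Q(3) K(2) T(1) by (auto simp: covered_def)
  ultimately show ?case using Q(1) K(1) by (intro exI[of _ "insert K Q"]) auto
qed

text \<open>A largest family of disjoint light copies leaves fewer than \<open>\<tau>\<close> vertices, as otherwise these
  would contain a further light clique. The rest is split arbitrarily, and the copies used for it are
  few enough to be repaired (with the zero weighting, as only existence matters).\<close>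

lemma exists_perfect_factor_in_robust:
  assumes rob: "robust n v \<tau> S" and dvd: "v dvd n"
  shows "\<exists>Q. (\<forall>K\<in>Q. is_copy H n K \<and> edges K \<subseteq> S) \<and> disjoint_family_on verts Q \<and> covered Q = {..<n}"
proof -
  define \<F> where "\<F> = {Q. (\<forall>K\<in>Q. is_copy H n K \<and> edges K \<subseteq> S) \<and> disjoint_family_on verts Q}"
  have "finite \<F>"
    by (rule finite_subset[of _ "Pow {K. subgraph K (complete_graph n)}"])
      (use finite_subgraphs in \<open>auto simp: \<F>_def is_copy_def\<close>)
  moreover have "{} \<in> \<F>" by (auto simp: \<F>_def disjoint_family_on_def)
  ultimately have "Max (card ` \<F>) \<in> card ` \<F>" "\<And>Q'. Q' \<in> \<F> \<Longrightarrow> card Q' \<le> Max (card ` \<F>)"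
    by (auto intro!: Max_in Max_ge)
  then obtain Q where Q: "Q \<in> \<F>" "\<And>Q'. Q' \<in> \<F> \<Longrightarrow> card Q' \<le> card Q"
    by (metis imageE)
  have Qc: "\<forall>K\<in>Q. is_copy H n K" "disjoint_family_on verts Q" "\<forall>K\<in>Q. edges K \<subseteq> S"
    using Q(1) by (auto simp: \<F>_def)
  define W where "W = {..<n} - covered Q"
  have covn: "covered Q \<subseteq> {..<n}" using covered_sub[OF Qc(1)] .
  have "card W < \<tau>"
  proof (rule ccontr)
    assume "\<not> card W < \<tau>"
    then have "\<tau> \<le> card W" "W \<subseteq> {..<n}" by (auto simp: W_def)
    then obtain T where T: "T \<subseteq> W" "card T = v" "clique_in S T"
      using rob unfolding robust_def by blast
    then obtain K where K: "is_copy H n K" "verts K = T" "edges K \<subseteq> S"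
      using copy_on_clique[of T n S] \<open>W \<subseteq> {..<n}\<close> by blast
    have TQ: "verts K \<inter> verts K' = {}" if "K' \<in> Q" for K'
      using T(1) K(2) that by (auto simp: W_def covered_def)
    have "K \<notin> Q" using TQ[of K] copyD(3)[OF K(1)] by blast
    moreover have "insert K Q \<in> \<F>"
      using Q(1) K TQ unfolding \<F>_def disjoint_family_on_def by (auto simp: Int_commute)
    ultimately show False
      using Q(2)[of "insert K Q"] finite_copies[OF Qc(1)] by simp
  qed
  have cW: "card W = n - v * card Q"
    unfolding W_def using card_covered[OF Qc(1,2)] covn finite_subset by (subst card_Diff_subset) auto
  obtain k where k: "card W = k * v"
    using dvd unfolding cW by (metis dvd_diff_nat dvd_triv_left dvdE mult.commute)
  then obtain B where B: "\<forall>K\<in>B. is_copy H n K" "disjoint_family_on verts B" "covered B = W"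
    using exists_partition_into_copies[of W n k] by (auto simp: W_def)
  have disj: "disjoint_family_on verts (Q \<union> B)"
    unfolding disjoint_family_on_def
  proof (intro ballI impI)
    fix K K' assume *: "K \<in> Q \<union> B" "K' \<in> Q \<union> B" "K \<noteq> K'"
    have QB: "verts K1 \<inter> verts K2 = {}" if "K1 \<in> Q" "K2 \<in> B" for K1 K2
      using that B(3) by (auto simp: W_def covered_def)
    show "verts K \<inter> verts K' = {}"
      using * QB[of K K'] QB[of K' K] B(2) Qc(2) unfolding disjoint_family_on_def by blast
  qed
  have "v * card B \<le> \<tau>" using card_covered[OF B(1,2)] B(3) \<open>card W < \<tau>\<close> by simp
  moreover have "\<forall>K\<in>Q \<union> B. is_copy H n K" "\<forall>K\<in>Q \<union> B - B. edges K \<subseteq> S" using Qc B by auto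
  ultimately obtain Q' where Q': "\<forall>K\<in>Q'. is_copy H n K \<and> edges K \<subseteq> S" "disjoint_family_on verts Q'"
    "card (covered Q') = card (covered (Q \<union> B))"
    using repair[OF rob, of "\<lambda>_. 0" 0 S "Q \<union> B" B] disj by auto
  have "covered (Q \<union> B) = {..<n}" using B(3) covn by (auto simp: W_def covered_def)
  then have "covered Q' = {..<n}"
    using Q'(1,3) covered_sub[of Q' n] by (intro card_subset_eq) auto
  then show ?thesis using Q' by blast
qed

text \<open>The edges outside \<open>L\<close> are heavy for \<open>w\<close> and out of control for \<open>w'\<close>. The assumption
  \<open>few\<close>, together with the perfect factor in the graph \<open>S'\<close>, says that an optimal factor has at most
  \<open>\<tau> / v\<close> copies with an edge outside \<open>L\<close>; by \<open>small\<close>, repairing one of them costs at most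
  \<open>\<delta>\<close> times its weight. One factor \<open>1 + \<delta>\<close> in the conclusion pays for the repairs, the other one for
  the passage from \<open>w\<close> to \<open>w'\<close>.\<close>

lemma factor_transfer:
  assumes dvd: "v dvd n" and m: "0 \<le> m" and n: "0 < n"
    and rob: "robust n v \<tau> S" and rob': "robust n v \<tau>' S'"
    and w: "\<And>e. e \<in> edges (complete_graph n) \<Longrightarrow> 0 \<le> w e"
    and S: "\<And>e. e \<in> S \<Longrightarrow> w e \<le> \<beta>" "0 \<le> \<beta>" "S \<subseteq> L"
    and S': "\<And>e. e \<in> S' \<Longrightarrow> w e \<le> \<beta>'" "0 \<le> \<beta>'"
    and heavy: "\<And>e. e \<in> edges (complete_graph n) \<Longrightarrow> e \<notin> L \<Longrightarrow> \<theta> \<le> w e" and \<theta>: "0 < \<theta>"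
    and few: "real v * (real n * (real eH * \<beta>')) \<le> real \<tau> * \<theta>"
    and small: "real (v\<^sup>2) * (real eH * \<beta>) \<le> \<delta> * \<theta>"
    and w': "\<And>e. e \<in> L \<Longrightarrow> e \<in> edges (complete_graph n) \<Longrightarrow> w' e \<le> (1 + \<delta>) * w e" and \<delta>: "0 \<le> \<delta>"
  shows "min_factor_weight H m n w' \<le> (1 + \<delta>)\<^sup>2 * min_factor_weight H m n w"
proof -
  obtain Q0 where Q0: "\<forall>K\<in>Q0. is_copy H n K \<and> edges K \<subseteq> S'" "disjoint_family_on verts Q0" "covered Q0 = {..<n}"
    using exists_perfect_factor_in_robust[OF rob' dvd] by blast
  have Q0F: "H_factor H (m / real n) n Q0" using Q0 m by (auto simp: H_factor_def H_cover_iff)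
  obtain Q where Q: "H_factor H (m / real n) n Q" and Qw: "min_factor_weight H m n w = total_weight w Q"
    using min_factor_weight_attained[OF Q0F] by blast
  have Qc: "\<forall>K\<in>Q. is_copy H n K" "disjoint_family_on verts Q"
    and Qcov: "real (card ({..<n} - covered Q)) \<le> m / real n * real n"
    using Q by (auto simp: H_factor_def H_cover_iff)
  have fQ: "finite Q" using Qc finite_copies by blast
  define B where "B = {K\<in>Q. \<not> edges K \<subseteq> L}"
  have B: "B \<subseteq> Q" by (auto simp: B_def)
  have wB: "real (card B) * \<theta> \<le> total_weight w B"
    unfolding total_weight_def
  proof (rule sum_bounded_below)
    fix K assume K: "K \<in> B"
    then have cK: "is_copy H n K" using Qc by (auto simp: B_def)
    obtain e where e: "e \<in> edges K" "e \<notin> L" using K by (auto simp: B_def)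
    have "\<theta> \<le> w e" using heavy e copyD(4)[OF cK] by blast
    also have "w e \<le> (\<Sum>e\<in>edges K. w e)"
      using e w copyD(4,5)[OF cK] by (intro member_le_sum) auto
    finally show "\<theta> \<le> (\<Sum>e\<in>edges K. w e)" .
  qed
  have wB0: "0 \<le> total_weight w (Q - B)" using Qc by (intro total_weight_nonneg[OF w]) auto
  have split: "total_weight w Q = total_weight w (Q - B) + total_weight w B"
    by (rule total_weight_split[OF fQ B])
  have "total_weight w Q \<le> total_weight w Q0"
    unfolding Qw[symmetric] by (rule min_factor_weight_le[OF Q0F])
  also have "\<dots> \<le> real (card Q0) * (real eH * \<beta>')"
    by (rule total_weight_le_card[OF Q0(1) S'])
  also have "\<dots> \<le> real n * (real eH * \<beta>')"
  proof -
    have "v * card Q0 = n" using card_covered[of Q0 n] Q0 by simp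
    then have "card Q0 \<le> n" using v_ge_2 by (cases v) auto
    then show ?thesis using S'(2) by (intro mult_right_mono) auto
  qed
  finally have "real v * (real (card B) * \<theta>) \<le> real v * (real n * (real eH * \<beta>'))"
    using wB wB0 split by (intro mult_left_mono) auto
  then have "real v * real (card B) * \<theta> \<le> real \<tau> * \<theta>" using few by simp
  then have "real v * real (card B) \<le> real \<tau>" using \<theta> by simp
  then have vB: "v * card B \<le> \<tau>" by (metis of_nat_le_iff of_nat_mult)
  have good: "\<forall>K\<in>Q - B. edges K \<subseteq> L" by (auto simp: B_def)
  have "\<exists>Q'. (\<forall>K\<in>Q'. is_copy H n K \<and> edges K \<subseteq> L) \<and> disjoint_family_on verts Q' \<and>
    card (covered Q') = card (covered Q) \<and>
    total_weight w Q' \<le> total_weight w (Q - B) + real (card B) * (real (v\<^sup>2) * (real eH * \<beta>))"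
    by (rule repair[where w = w, OF rob w S Qc B vB good])
  then obtain Q' where Q': "\<forall>K\<in>Q'. is_copy H n K \<and> edges K \<subseteq> L" "disjoint_family_on verts Q'"
    "card (covered Q') = card (covered Q)"
    "total_weight w Q' \<le> total_weight w (Q - B) + real (card B) * (real (v\<^sup>2) * (real eH * \<beta>))"
    by - (elim exE conjE, rule that)
  have "real (card B) * (real (v\<^sup>2) * (real eH * \<beta>)) \<le> real (card B) * (\<delta> * \<theta>)"
    using small by (intro mult_left_mono) auto
  also have "\<dots> = \<delta> * (real (card B) * \<theta>)" by simp
  also have "\<dots> \<le> \<delta> * total_weight w B" using wB \<delta> by (rule mult_left_mono)
  finally have "total_weight w Q' \<le> total_weight w (Q - B) + \<delta> * total_weight w B" using Q'(4) by linarith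
  also have "\<dots> \<le> (1 + \<delta>) * total_weight w Q"
  proof -
    have "0 \<le> total_weight w B" using Qc B by (intro total_weight_nonneg[OF w]) auto
    moreover have "0 \<le> \<delta> * total_weight w (Q - B)" using wB0 \<delta> by simp
    ultimately show ?thesis unfolding split by (simp add: algebra_simps)
  qed
  finally have wQ': "total_weight w Q' \<le> (1 + \<delta>) * total_weight w Q" .
  have "card ({..<n} - covered Q') = card ({..<n} - covered Q)"
    using Q'(1,3) covered_sub[of Q' n] covered_sub[OF Qc(1)] finite_subset[of _ "{..<n}"]
    by (subst (1 2) card_Diff_subset) auto
  then have "H_factor H (m / real n) n Q'" using Q' Qcov by (auto simp: H_factor_def H_cover_iff)
  then have "min_factor_weight H m n w' \<le> total_weight w' Q'" by (rule min_factor_weight_le)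
  also have "\<dots> \<le> (1 + \<delta>) * total_weight w Q'"
    unfolding total_weight_def sum_distrib_left
  proof (intro sum_mono)
    fix K e assume "K \<in> Q'" "e \<in> edges K"
    then show "w' e \<le> (1 + \<delta>) * w e" using Q'(1) copyD(4) w' by blast
  qed
  also have "\<dots> \<le> (1 + \<delta>) * ((1 + \<delta>) * total_weight w Q)" using wQ' \<delta> by (intro mult_left_mono) auto
  finally show ?thesis unfolding Qw by (simp add: power2_eq_square mult.assoc)
qed

lemma vertex_in_light_copy:
  assumes rob: "robust n v \<tau> S" and SE: "S \<subseteq> edges (complete_graph n)" and u: "u < n"
  shows "\<exists>K. is_copy H n K \<and> u \<in> verts K \<and> edges K \<subseteq> S"
proof -
  let ?N = "{w\<in>{..<n}. {u, w} \<in> S}"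
  have "\<tau> \<le> card ?N" using rob u by (fastforce simp: robust_def)
  moreover have "?N \<subseteq> {..<n}" by auto
  ultimately obtain T where T: "T \<subseteq> ?N" "card T = v" "clique_in S T"
    using rob unfolding robust_def by blast
  then obtain t where t: "t \<in> T" using v_ge_2 by fastforce
  have fT: "finite T" using T(2) v_ge_2 by (metis card.infinite not_numeral_le_zero)
  have "{u, u} \<notin> S" using SE by (auto simp: edge_complete_iff)
  then have uT: "u \<notin> T" using T(1) by auto
  let ?T = "insert u (T - {t})"
  have "card ?T = v" using uT t fT T(2) v_ge_2 by simp
  moreover have "clique_in S ?T"
    using T(1,3) unfolding clique_in_def by (auto simp: insert_commute)
  moreover have "?T \<subseteq> {..<n}" using T(1) u by auto
  ultimately obtain K where "is_copy H n K" "verts K = ?T" "edges K \<subseteq> S"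
    using copy_on_clique[of ?T n S] by blast
  then show ?thesis by (intro exI[of _ K]) auto
qed

text \<open>Copies in a cover may overlap, so each vertex of a heavy copy is simply covered by a light copy
  of its own, however many heavy copies there are.\<close>

lemma cover_transfer:
  assumes m: "0 \<le> m" and n: "0 < n"
    and rob: "robust n v \<tau> S" and SE: "S \<subseteq> edges (complete_graph n)"
    and w: "\<And>e. e \<in> edges (complete_graph n) \<Longrightarrow> 0 \<le> w e"
    and S: "\<And>e. e \<in> S \<Longrightarrow> w e \<le> \<beta>" "0 \<le> \<beta>" "S \<subseteq> L"
    and heavy: "\<And>e. e \<in> edges (complete_graph n) \<Longrightarrow> e \<notin> L \<Longrightarrow> \<theta> \<le> w e"
    and small: "real (v\<^sup>2) * (real eH * \<beta>) \<le> \<delta> * \<theta>"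
    and w': "\<And>e. e \<in> L \<Longrightarrow> e \<in> edges (complete_graph n) \<Longrightarrow> w' e \<le> (1 + \<delta>) * w e" and \<delta>: "0 \<le> \<delta>"
  shows "min_cover_weight H m n w' \<le> (1 + \<delta>)\<^sup>2 * min_cover_weight H m n w"
proof -
  obtain k where k: "\<And>u. u < n \<Longrightarrow> is_copy H n (k u) \<and> u \<in> verts (k u) \<and> edges (k u) \<subseteq> S"
    using vertex_in_light_copy[OF rob SE] by metis
  have "{..<n} - covered (k ` {..<n}) = {}" using k by (auto simp: covered_def)
  then have "H_cover H (m / real n) n (k ` {..<n})"
    unfolding H_cover_iff using k m by (simp only:) auto
  then obtain Q where Q: "H_cover H (m / real n) n Q" and Qw: "min_cover_weight H m n w = total_weight w Q"
    using min_cover_weight_attained by blast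
  have Qc: "\<forall>K\<in>Q. is_copy H n K"
    and Qcov: "real (card ({..<n} - covered Q)) \<le> m / real n * real n"
    using Q by (auto simp: H_cover_iff)
  have fQ: "finite Q" using Qc finite_copies by blast
  define B where "B = {K\<in>Q. \<not> edges K \<subseteq> L}"
  have B: "B \<subseteq> Q" by (auto simp: B_def)
  have wB: "real (card B) * \<theta> \<le> total_weight w B"
    unfolding total_weight_def
  proof (rule sum_bounded_below)
    fix K assume K: "K \<in> B"
    then have cK: "is_copy H n K" using Qc by (auto simp: B_def)
    obtain e where e: "e \<in> edges K" "e \<notin> L" using K by (auto simp: B_def)
    have "\<theta> \<le> w e" using heavy e copyD(4)[OF cK] by blast
    also have "w e \<le> (\<Sum>e\<in>edges K. w e)"
      using e w copyD(4,5)[OF cK] by (intro member_le_sum) auto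
    finally show "\<theta> \<le> (\<Sum>e\<in>edges K. w e)" .
  qed
  have wB0: "0 \<le> total_weight w (Q - B)" using Qc by (intro total_weight_nonneg[OF w]) auto
  have split: "total_weight w Q = total_weight w (Q - B) + total_weight w B"
    by (rule total_weight_split[OF fQ B])
  define C where "C = k ` covered B"
  have covB: "covered B \<subseteq> {..<n}" using covered_sub[of B n] Qc B by auto
  have cC: "\<forall>K\<in>C. is_copy H n K \<and> edges K \<subseteq> S" using k covB by (auto simp: C_def)
  define Q' where "Q' = (Q - B) \<union> C"
  have Q'c: "\<forall>K\<in>Q'. is_copy H n K \<and> edges K \<subseteq> L" using Qc cC S(3) by (auto simp: Q'_def B_def)
  have "card C \<le> card B * v"
  proof -
    have "card C \<le> card (covered B)"
      unfolding C_def using covB finite_subset by (intro card_image_le) auto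
    also have "\<dots> \<le> (\<Sum>K\<in>B. card (verts K))"
      unfolding covered_def using fQ B finite_subset by (intro card_UN_le) auto
    also have "\<dots> = card B * v"
    proof -
      have "card (verts K) = v" if "K \<in> B" for K using Qc B that copyD(1) by blast
      then show ?thesis by simp
    qed
    finally show ?thesis .
  qed
  also have "\<dots> \<le> card B * v\<^sup>2" by (intro mult_le_mono2) (simp add: power2_eq_square)
  finally have cardC: "real (card C) \<le> real (card B) * real (v\<^sup>2)"
    by (metis of_nat_le_iff of_nat_mult)
  have "total_weight w Q' \<le> total_weight w (Q - B) + total_weight w C"
    unfolding Q'_def by (rule total_weight_Un_le[OF w]) (use Qc cC in auto)
  also have "total_weight w C \<le> real (card C) * (real eH * \<beta>)"
    by (rule total_weight_le_card[OF cC S(1,2)])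
  also have "\<dots> \<le> real (card B) * real (v\<^sup>2) * (real eH * \<beta>)"
    using cardC S(2) by (intro mult_right_mono) auto
  also have "\<dots> = real (card B) * (real (v\<^sup>2) * (real eH * \<beta>))" by simp
  also have "\<dots> \<le> real (card B) * (\<delta> * \<theta>)" using small by (intro mult_left_mono) auto
  also have "\<dots> = \<delta> * (real (card B) * \<theta>)" by simp
  also have "\<dots> \<le> \<delta> * total_weight w B" using wB \<delta> by (rule mult_left_mono)
  also have "total_weight w (Q - B) + \<delta> * total_weight w B \<le> (1 + \<delta>) * total_weight w Q"
  proof -
    have "0 \<le> total_weight w B" using Qc B by (intro total_weight_nonneg[OF w]) auto
    moreover have "0 \<le> \<delta> * total_weight w (Q - B)" using wB0 \<delta> by simp
    ultimately show ?thesis unfolding split by (simp add: algebra_simps)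
  qed
  finally have wQ': "total_weight w Q' \<le> (1 + \<delta>) * total_weight w Q" by simp
  have "covered Q \<subseteq> covered Q'"
  proof
    fix u assume "u \<in> covered Q"
    then consider "u \<in> covered (Q - B)" | "u \<in> covered B" by (auto simp: covered_def)
    then show "u \<in> covered Q'"
    proof cases
      case 2
      then have "u \<in> verts (k u)" "k u \<in> C" using k covB by (auto simp: C_def)
      then show ?thesis by (auto simp: covered_def Q'_def)
    qed (auto simp: covered_def Q'_def)
  qed
  then have "card ({..<n} - covered Q') \<le> card ({..<n} - covered Q)" by (intro card_mono) auto
  then have "H_cover H (m / real n) n Q'" using Q'c Qcov by (auto simp: H_cover_iff)
  then have "min_cover_weight H m n w' \<le> total_weight w' Q'" by (rule min_cover_weight_le)
  also have "\<dots> \<le> (1 + \<delta>) * total_weight w Q'"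
    unfolding total_weight_def sum_distrib_left
  proof (intro sum_mono)
    fix K e assume "K \<in> Q'" "e \<in> edges K"
    then show "w' e \<le> (1 + \<delta>) * w e" using Q'c copyD(4) w' by blast
  qed
  also have "\<dots> \<le> (1 + \<delta>) * ((1 + \<delta>) * total_weight w Q)" using wQ' \<delta> by (intro mult_left_mono) auto
  finally show ?thesis unfolding Qw by (simp add: power2_eq_square mult.assoc)
qed

text \<open>It is here that \<open>m / n < 1\<close> matters: something has to be covered, so the quotients of minimal
  weights are not \<open>0 / 0\<close>.\<close>

lemma total_weight_pos:
  assumes "H_cover H (m / real n) n Q" "0 < n" "m / real n < 1"
    and "\<And>e. e \<in> edges (complete_graph n) \<Longrightarrow> 0 < w e"
  shows "0 < total_weight w Q"
proof -
  have Qc: "\<forall>K\<in>Q. is_copy H n K" and cov: "real (card ({..<n} - covered Q)) \<le> m / real n * real n"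
    using assms(1) by (auto simp: H_cover_iff)
  have "m / real n * real n < 1 * real n" using assms(2,3) by (intro mult_strict_right_mono) auto
  then have "Q \<noteq> {}" using cov by (auto simp: covered_def)
  with finite_copies[OF Qc] show ?thesis
    unfolding total_weight_def
  proof (rule sum_pos)
    fix K assume "K \<in> Q"
    then have "is_copy H n K" using Qc by blast
    then show "0 < (\<Sum>e\<in>edges K. w e)"
      using copyD(4,5,6) assms(4) by (intro sum_pos) blast+
  qed
qed

lemma min_cover_weight_pos:
  assumes "0 < n" "m / real n < 1" "0 \<le> m" "robust n v \<tau> S" "S \<subseteq> edges (complete_graph n)"
    and "\<And>e. e \<in> edges (complete_graph n) \<Longrightarrow> 0 < w e"
  shows "0 < min_cover_weight H m n w"
proof -
  obtain k where k: "\<And>u. u < n \<Longrightarrow> is_copy H n (k u) \<and> u \<in> verts (k u) \<and> edges (k u) \<subseteq> S"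
    using vertex_in_light_copy[OF assms(4,5)] by metis
  have "{..<n} - covered (k ` {..<n}) = {}" using k by (auto simp: covered_def)
  then have "H_cover H (m / real n) n (k ` {..<n})"
    unfolding H_cover_iff using k assms(3) by (simp only:) auto
  from min_cover_weight_attained[OF this] show ?thesis using total_weight_pos assms by metis
qed

lemma min_factor_weight_pos:
  assumes "0 < n" "m / real n < 1" "0 \<le> m" "v dvd n"
    and "\<And>e. e \<in> edges (complete_graph n) \<Longrightarrow> 0 < w e"
  shows "0 < min_factor_weight H m n w"
proof -
  obtain k where "card {..<n} = k * v" using assms(4) by (metis card_lessThan dvdE mult.commute)
  then obtain Q where "\<forall>K\<in>Q. is_copy H n K" "disjoint_family_on verts Q" "covered Q = {..<n}"
    using exists_partition_into_copies by blast
  then have "H_factor H (m / real n) n Q" using assms(3) by (auto simp: H_factor_def H_cover_iff)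
  from min_factor_weight_attained[OF this] show ?thesis
    using total_weight_pos assms unfolding H_factor_def by metis
qed

end

section \<open>The coupling\<close>

text \<open>If \<open>X\<close> is exponential, then \<open>1 - exp (- X)\<close> is uniform, so \<open>\<phi> (X)\<close> has law \<open>\<nu>\<close> for
  \<open>\<phi> x\<close> the generalised inverse of the distribution function at \<open>1 - exp (- x)\<close>. Near 0 both
  the distribution function and \<open>x \<mapsto> 1 - exp (- x)\<close> are asymptotic to the identity, hence so is \<open>\<phi>\<close>.\<close>

lemma quantile_transform:
  assumes "real_distribution \<nu>" and lim: "((\<lambda>x. cdf \<nu> x / x) \<longlongrightarrow> 1) (at_right 0)"
  obtains \<phi> :: "real \<Rightarrow> real" where "mono \<phi>" "\<And>x. 0 < x \<Longrightarrow> 0 < \<phi> x"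
    "distr exp_law borel \<phi> = \<nu>"
    "\<And>\<delta>. 0 < \<delta> \<Longrightarrow> \<exists>r>0. \<forall>x. 0 < x \<and> x \<le> r \<longrightarrow> x \<le> (1 + \<delta>) * \<phi> x \<and> \<phi> x \<le> (1 + \<delta>) * x"
proof -
  interpret cdf_distribution \<nu> by (simp add: cdf_distribution_def assms(1))
  interpret X: prob_space exp_law by (rule prob_space_exp_law)
  \<comment> \<open>The value 0 off the positive axis, on a null set, makes \<open>\<phi>\<close> monotone on the whole line.\<close>
  define \<phi> where "\<phi> x = (if 0 < x then I (1 - exp (- x)) else 0)" for x
  have inv: "\<phi> x \<le> z \<longleftrightarrow> 1 - exp (- x) \<le> C z" if "0 < x" for x z
    using pseudoinverse[of "1 - exp (- x)" z] that by (simp add: \<phi>_def)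
  have near: "\<exists>r>0. \<forall>z. 0 < z \<and> z \<le> r \<longrightarrow> a * z < C z \<and> C z < b * z" if "a < 1" "1 < b" for a b
  proof -
    have "\<forall>\<^sub>F z in at_right 0. a < C z / z \<and> C z / z < b"
      using order_tendstoD[OF lim] that by (intro eventually_conj) auto
    then obtain r where r: "0 < r" "\<And>z. 0 < z \<Longrightarrow> z < r \<Longrightarrow> a < C z / z \<and> C z / z < b"
      unfolding eventually_at_right_field by auto
    have "a * z < C z \<and> C z < b * z" if "0 < z" "z \<le> r / 2" for z
      using r(2)[of z] r(1) that by (auto simp: field_simps)
    then show ?thesis using r(1) by (intro exI[of _ "r / 2"]) auto
  qed
  have C0: "C 0 = 0"
  proof (rule antisym)
    show "C 0 \<le> 0"
    proof (rule field_le_epsilon)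
      fix e :: real assume e: "0 < e"
      obtain r where r: "0 < r" "\<And>z. 0 < z \<Longrightarrow> z \<le> r \<Longrightarrow> C z < 2 * z" using near[of 0 2] by auto
      define z where "z = min r (e / 2)"
      have "0 < z" "z \<le> r" "2 * z \<le> e" using r(1) e by (auto simp: z_def)
      then show "C 0 \<le> 0 + e" using r(2)[of z] cdf_nondecreasing[of 0 z] by linarith
    qed
  qed (rule cdf_nonneg)
  have pos: "0 < \<phi> x" if "0 < x" for x using inv[OF that, of 0] C0 that by auto
  have mono_\<phi>: "mono \<phi>"
  proof (rule monoI)
    fix x y :: real assume "x \<le> y"
    show "\<phi> x \<le> \<phi> y"
    proof (cases "0 < x")
      case True
      then have "1 - exp (- y) \<le> C (\<phi> y)" using inv[of y "\<phi> y"] \<open>x \<le> y\<close> by simp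
      moreover have "1 - exp (- x) \<le> 1 - exp (- y)" using \<open>x \<le> y\<close> by simp
      ultimately have "1 - exp (- x) \<le> C (\<phi> y)" by linarith
      then show ?thesis using inv[OF True] by simp
    next
      case False
      then show ?thesis using pos[of y] by (cases "0 < y") (auto simp: \<phi>_def)
    qed
  qed
  then have [measurable]: "\<phi> \<in> borel_measurable borel" by (rule borel_measurable_mono)
  have AE_pos: "AE x in exp_law. 0 < x"
  proof -
    have "X.prob {..0} = 0" using prob_exp_law_le[of 0] by simp
    then have "{..0} \<in> null_sets exp_law" by (auto simp: null_sets_def X.emeasure_eq_measure)
    then show ?thesis by (rule AE_I') auto
  qed
  have "cdf (distr exp_law borel \<phi>) z = C z" for z
  proof -
    have "cdf (distr exp_law borel \<phi>) z = X.prob {x. \<phi> x \<le> z}"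
      unfolding cdf_def by (subst measure_distr) (auto intro!: arg_cong[where f = X.prob])
    also have "\<dots> = C z"
    proof (cases "C z < 1")
      case True
      define a where "a = - ln (1 - C z)"
      have a: "0 \<le> a" "exp (- a) = 1 - C z" using True cdf_nonneg[of z] by (auto simp: a_def)
      have "\<phi> x \<le> z \<longleftrightarrow> x \<le> a" if "0 < x" for x
      proof -
        have "\<phi> x \<le> z \<longleftrightarrow> exp (- a) \<le> exp (- x)" unfolding inv[OF that] a(2) by linarith
        then show ?thesis by simp
      qed
      then have "X.prob {x. \<phi> x \<le> z} = X.prob {..a}"
        using AE_pos by (intro X.finite_measure_eq_AE) auto
      also have "\<dots> = C z" using prob_exp_law_le[OF a(1)] a(2) by simp
      finally show ?thesis .
    next
      case False
      then have "C z = 1" using cdf_bounded_prob[of z] by linarith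
      then have "\<phi> x \<le> z" if "0 < x" for x using inv[OF that] by simp
      then have "X.prob {x. \<phi> x \<le> z} = X.prob (space exp_law)"
        using AE_pos by (intro X.finite_measure_eq_AE) auto
      then show ?thesis using X.prob_space \<open>C z = 1\<close> by simp
    qed
    finally show ?thesis .
  qed
  then have distr_\<phi>: "distr exp_law borel \<phi> = \<nu>"
    by (intro cdf_unique real_distribution.intro X.prob_space_distr ext assms real_distribution_axioms.intro) auto
  have "\<exists>r>0. \<forall>x. 0 < x \<and> x \<le> r \<longrightarrow> x \<le> (1 + \<delta>) * \<phi> x \<and> \<phi> x \<le> (1 + \<delta>) * x" if \<delta>: "0 < \<delta>" for \<delta>
  proof -
    obtain s where s: "0 < s"
      "\<And>z. 0 < z \<Longrightarrow> z \<le> s \<Longrightarrow> inverse (1 + \<delta>) * z < C z \<and> C z < (1 + \<delta> / 2) * z"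
      using near[of "inverse (1 + \<delta>)" "1 + \<delta> / 2"] \<delta> by (auto simp: field_simps)
    define r where "r = min (s / (1 + \<delta>)) (\<delta> / (4 * (1 + \<delta>)))"
    have r0: "0 < r" using s(1) \<delta> by (simp add: r_def)
    have "r \<le> s / (1 + \<delta>)" "r \<le> \<delta> / (4 * (1 + \<delta>))" by (auto simp: r_def)
    then have "r * (1 + \<delta>) \<le> s" "r * (4 * (1 + \<delta>)) \<le> \<delta>"
      using \<delta> by (simp_all add: pos_le_divide_eq)
    then have r: "0 < r" "(1 + \<delta>) * r \<le> s" "r * (1 + \<delta>) \<le> \<delta> / 4"
      using r0 by (simp_all add: algebra_simps)
    have "x \<le> (1 + \<delta>) * \<phi> x \<and> \<phi> x \<le> (1 + \<delta>) * x" if x: "0 < x" "x \<le> r" for x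
    proof
      have "(1 + \<delta>) * x \<le> (1 + \<delta>) * r" using x \<delta> by (intro mult_left_mono) auto
      then have le_s: "(1 + \<delta>) * x \<le> s" using r(2) by linarith
      have "inverse (1 + \<delta>) * ((1 + \<delta>) * x) < C ((1 + \<delta>) * x)"
        using s(2)[of "(1 + \<delta>) * x"] le_s x \<delta> by auto
      moreover have "inverse (1 + \<delta>) * ((1 + \<delta>) * x) = x" using \<delta> by simp
      moreover have "1 - exp (- x) \<le> x" using exp_ge_add_one_self[of "- x"] by linarith
      ultimately show "\<phi> x \<le> (1 + \<delta>) * x" using inv[OF x(1)] by simp
    next
      show "x \<le> (1 + \<delta>) * \<phi> x"
      proof (rule ccontr)
        assume "\<not> x \<le> (1 + \<delta>) * \<phi> x"
        then have "\<phi> x \<le> x / (1 + \<delta>)" using \<delta> by (simp add: field_simps)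
        then have u: "1 - exp (- x) \<le> C (x / (1 + \<delta>))" using inv[OF x(1)] by simp
        have "x / (1 + \<delta>) \<le> x" using x \<delta> by (simp add: field_simps)
        also have "x \<le> (1 + \<delta>) * x" using x \<delta> by simp
        also have "\<dots> \<le> (1 + \<delta>) * r" using x \<delta> by (intro mult_left_mono) auto
        finally have "x / (1 + \<delta>) \<le> s" using r(2) by linarith
        then have "C (x / (1 + \<delta>)) < (1 + \<delta> / 2) * (x / (1 + \<delta>))"
          using s(2)[of "x / (1 + \<delta>)"] x \<delta> by simp
        moreover have "x / (1 + x) \<le> 1 - exp (- x)"
        proof -
          have "exp (- x) \<le> inverse (1 + x)"
            unfolding exp_minus using x exp_ge_add_one_self[of x] by (intro le_imp_inverse_le) auto
          moreover have "1 - inverse (1 + x) = x / (1 + x)" using x by (simp add: field_simps)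
          ultimately show ?thesis by linarith
        qed
        ultimately have "x / (1 + x) < (1 + \<delta> / 2) * (x / (1 + \<delta>))" using u by linarith
        then have "x * (1 / (1 + x)) < x * ((1 + \<delta> / 2) / (1 + \<delta>))"
          by (simp add: mult.commute)
        then have "1 / (1 + x) < (1 + \<delta> / 2) / (1 + \<delta>)"
          using x(1) by (simp only: mult_less_cancel_left_pos)
        then have "1 + \<delta> < (1 + \<delta> / 2) * (1 + x)"
          using x \<delta> by (simp add: pos_divide_less_eq pos_less_divide_eq)
        moreover have "(1 + \<delta> / 2) * x \<le> \<delta> / 4"
        proof -
          have "(1 + \<delta> / 2) * x \<le> (1 + \<delta>) * r" using x \<delta> by (intro mult_mono) auto
          then show ?thesis using r(3) by (simp add: mult.commute)
        qed
        ultimately show False using \<delta> by (simp add: distrib_left)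
      qed
    qed
    then show ?thesis using r(1) by blast
  qed
  then show ?thesis using that[OF mono_\<phi> pos distr_\<phi>] by blast
qed

definition image_weights :: "nat \<Rightarrow> (real \<Rightarrow> real) \<Rightarrow> (nat set \<Rightarrow> real) \<Rightarrow> nat set \<Rightarrow> real" where
  "image_weights n \<phi> x = (\<lambda>e\<in>edges (complete_graph n). \<phi> (x e))"

lemma measurable_image_weights:
  assumes [measurable]: "\<phi> \<in> borel_measurable borel"
  shows "image_weights n \<phi> \<in> measurable (exp_weight_law n) (\<Pi>\<^sub>M e\<in>edges (complete_graph n). borel)"
  unfolding image_weights_def by (intro measurable_restrict measurable_compose[OF measurable_exp_weight assms])

text \<open>For \<open>n < 2\<close> there are no edges; the index set is then empty, and both laws are the point mass on
  the empty family.\<close>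

lemma distr_image_weights:
  assumes [measurable]: "\<phi> \<in> borel_measurable borel" and \<nu>: "distr exp_law borel \<phi> = \<nu>"
    and M: "prob_space M" "prob_space.indep_vars M (\<lambda>_. borel) Z (edges (complete_graph n))"
    and Z: "\<And>e. e \<in> edges (complete_graph n) \<Longrightarrow> distr M borel (Z e) = \<nu>"
  shows "distr (exp_weight_law n) (\<Pi>\<^sub>M e\<in>edges (complete_graph n). borel) (image_weights n \<phi>) = weight_law n M Z"
proof -
  let ?E = "edges (complete_graph n)"
  interpret prob_space M by fact
  interpret N: prob_space "exp_weight_law n" by (rule prob_space_exp_weight_law)
  interpret X: prob_space exp_law by (rule prob_space_exp_law)
  show ?thesis
  proof (cases "?E = {}")
    case True
    have eq: "distr N (PiM {} (\<lambda>_. borel :: real measure)) (\<lambda>_. u) = return (PiM {} (\<lambda>_. borel)) u"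
      if "prob_space N" "u \<in> space (PiM {} (\<lambda>_. borel :: real measure))"
      for N :: "'x measure" and u :: "nat set \<Rightarrow> real"
    proof (rule measure_eqI)
      fix A assume "A \<in> sets (distr N (PiM {} (\<lambda>_. borel :: real measure)) (\<lambda>_. u))"
      then show "emeasure (distr N (PiM {} (\<lambda>_. borel)) (\<lambda>_. u)) A = emeasure (return (PiM {} (\<lambda>_. borel)) u) A"
        using that prob_space.emeasure_space_1[OF that(1)]
        by (cases "u \<in> A") (auto simp: emeasure_distr)
    qed simp
    have restr: "(\<lambda>e\<in>{}. f e) = (\<lambda>_. undefined)" for f :: "nat set \<Rightarrow> real"
      by (simp add: restrict_def)
    show ?thesis
      unfolding weight_law_def image_weights_def True restr
      using eq[OF M(1), of "\<lambda>_. undefined"] eq[OF N.prob_space_axioms, of "\<lambda>_. undefined"]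
      by (simp add: space_PiM)
  next
    case False
    have s\<nu>: "sets \<nu> = sets borel" unfolding \<nu>[symmetric] by simp
    have p\<nu>: "prob_space \<nu>" unfolding \<nu>[symmetric] by (rule X.prob_space_distr) simp
    have m\<phi>: "\<phi> \<in> measurable exp_law \<nu>"
      using measurable_cong_sets[of exp_law borel \<nu> borel] s\<nu> assms(1) by auto
    have rv: "Z e \<in> borel_measurable M" if "e \<in> ?E" for e using M(2) that by (simp add: indep_vars_def)
    have "weight_law n M Z = (\<Pi>\<^sub>M e\<in>?E. distr M borel (Z e))"
      unfolding weight_law_def using indep_vars_iff_distr_eq_PiM'[OF False rv] M(2) by simp
    also have "\<dots> = (\<Pi>\<^sub>M e\<in>?E. distr exp_law \<nu> \<phi>)"
      using Z s\<nu> by (intro PiM_cong) (auto simp: \<nu>[symmetric] intro!: distr_cong)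
    also have "\<dots> = distr (exp_weight_law n) (\<Pi>\<^sub>M e\<in>?E. \<nu>) (compose ?E \<phi>)"
      unfolding exp_weight_law_def
      by (rule distr_PiM_finite_prob_space'[symmetric]) (use X.prob_space_axioms p\<nu> m\<phi> in auto)
    also have "\<dots> = distr (exp_weight_law n) (\<Pi>\<^sub>M e\<in>?E. borel) (compose ?E \<phi>)"
      using s\<nu> by (intro distr_cong sets_PiM_cong) auto
    also have "compose ?E \<phi> = image_weights n \<phi>" by (auto simp: compose_def image_weights_def)
    finally show ?thesis by simp
  qed
qed

definition exp_coupling ::
  "nat \<Rightarrow> (real \<Rightarrow> real) \<Rightarrow> ((nat set \<Rightarrow> real) \<times> (nat set \<Rightarrow> real)) measure" where
  "exp_coupling n \<phi> = distr (exp_weight_law n)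
     ((\<Pi>\<^sub>M e\<in>edges (complete_graph n). borel) \<Otimes>\<^sub>M exp_weight_law n) (\<lambda>x. (image_weights n \<phi> x, x))"

lemma measurable_coupling_map:
  assumes "\<phi> \<in> borel_measurable borel"
  shows "(\<lambda>x. (image_weights n \<phi> x, x)) \<in>
    measurable (exp_weight_law n) ((\<Pi>\<^sub>M e\<in>edges (complete_graph n). borel) \<Otimes>\<^sub>M exp_weight_law n)"
  using measurable_image_weights[OF assms] by (intro measurable_Pair) auto

lemma is_coupling_exp_coupling:
  assumes \<phi>: "\<phi> \<in> borel_measurable borel"
    and A: "distr (exp_weight_law n) (\<Pi>\<^sub>M e\<in>edges (complete_graph n). borel) (image_weights n \<phi>) = A"
  shows "is_coupling (exp_coupling n \<phi>) A (exp_weight_law n)"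
proof -
  let ?B = "\<Pi>\<^sub>M e\<in>edges (complete_graph n). (borel :: real measure)"
  have sA: "sets A = sets ?B" unfolding A[symmetric] by simp
  note m = measurable_coupling_map[OF \<phi>, of n]
  have "prob_space (exp_coupling n \<phi>)"
    unfolding exp_coupling_def by (rule prob_space.prob_space_distr[OF prob_space_exp_weight_law m])
  moreover have "sets (exp_coupling n \<phi>) = sets (A \<Otimes>\<^sub>M exp_weight_law n)"
    unfolding exp_coupling_def using sA by (simp cong: sets_pair_measure_cong)
  moreover have "distr (exp_coupling n \<phi>) A fst = A"
  proof -
    have "distr (exp_coupling n \<phi>) A fst = distr (exp_coupling n \<phi>) ?B fst"
      using sA by (intro distr_cong) auto
    also have "\<dots> = distr (exp_weight_law n) ?B (fst \<circ> (\<lambda>x. (image_weights n \<phi> x, x)))"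
      unfolding exp_coupling_def by (rule distr_distr[OF measurable_fst m])
    also have "\<dots> = A" using A by (simp add: comp_def)
    finally show ?thesis .
  qed
  moreover have "distr (exp_coupling n \<phi>) (exp_weight_law n) snd = exp_weight_law n"
    unfolding exp_coupling_def by (subst distr_distr[OF measurable_snd m]) (simp add: comp_def distr_id2)
  ultimately show ?thesis unfolding is_coupling_def by blast
qed

lemma borel_measurable_total_weight:
  assumes "Q \<subseteq> {K. subgraph K (complete_graph n)}"
  shows "(\<lambda>w. total_weight w Q) \<in> borel_measurable (\<Pi>\<^sub>M e\<in>edges (complete_graph n). borel)"
  unfolding total_weight_def
proof (intro borel_measurable_sum)
  fix K e assume "K \<in> Q" "e \<in> edges K"
  then have "e \<in> edges (complete_graph n)" using assms by (auto simp: subgraph_def)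
  then show "(\<lambda>w. w e) \<in> borel_measurable (\<Pi>\<^sub>M e\<in>edges (complete_graph n). borel)"
    by (rule measurable_component_singleton)
qed

lemma borel_measurable_min_cover_weight:
  "min_cover_weight H m n \<in> borel_measurable (\<Pi>\<^sub>M e\<in>edges (complete_graph n). borel)"
  unfolding min_cover_weight_def
  by (intro borel_measurable_Min finite_covers borel_measurable_total_weight) (auto simp: H_cover_def)

lemma borel_measurable_min_factor_weight:
  "min_factor_weight H m n \<in> borel_measurable (\<Pi>\<^sub>M e\<in>edges (complete_graph n). borel)"
  unfolding min_factor_weight_def
  by (intro borel_measurable_Min finite_factors borel_measurable_total_weight)
    (auto simp: H_factor_def H_cover_def)

definition comparable :: "real \<Rightarrow> real \<Rightarrow> real \<Rightarrow> bool" where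
  "comparable c a b \<longleftrightarrow> 0 < b \<and> a \<le> c * b \<and> b \<le> c * a"

lemma ratio_near_one:
  assumes "comparable ((1 + \<delta>)\<^sup>2) a b" and \<delta>: "0 < \<delta>" "\<delta> \<le> 1" "3 * \<delta> \<le> \<epsilon>"
  shows "\<bar>a / b - 1\<bar> \<le> \<epsilon>"
proof -
  have ab: "0 < b" "a \<le> (1 + \<delta>)\<^sup>2 * b" "b \<le> (1 + \<delta>)\<^sup>2 * a"
    using assms(1) by (auto simp: comparable_def)
  have "\<delta> * \<delta> \<le> 1 * \<delta>" using \<delta> by (intro mult_right_mono) auto
  moreover have "(1 + \<delta>)\<^sup>2 = 1 + 2 * \<delta> + \<delta> * \<delta>" by (simp add: power2_eq_square algebra_simps)
  ultimately have d: "(1 + \<delta>)\<^sup>2 \<le> 1 + \<epsilon>" using \<delta>(3) by linarith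
  have a: "0 < a"
    using ab(1,3) by (smt (verit) mult_nonneg_nonpos zero_le_power2)
  have "a \<le> (1 + \<epsilon>) * b" using ab(1,2) mult_right_mono[OF d, of b] by linarith
  then have "a / b \<le> 1 + \<epsilon>" using ab(1) by (simp add: divide_le_eq)
  moreover have "1 - \<epsilon> \<le> a / b"
  proof -
    have "b \<le> (1 + \<epsilon>) * a" using a ab(3) mult_right_mono[OF d, of a] by linarith
    moreover have "(1 - \<epsilon>) * ((1 + \<epsilon>) * a) \<le> a"
    proof -
      have "0 \<le> \<epsilon> * \<epsilon> * a" using a by simp
      moreover have "(1 - \<epsilon>) * ((1 + \<epsilon>) * a) = a - \<epsilon> * \<epsilon> * a" by (simp add: algebra_simps)
      ultimately show ?thesis by linarith
    qed
    moreover have "(1 - \<epsilon>) * b \<le> (1 - \<epsilon>) * ((1 + \<epsilon>) * a) \<or> 1 - \<epsilon> \<le> 0"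
      using calculation(1) by (cases "1 - \<epsilon> \<le> 0") (auto intro: mult_left_mono)
    ultimately have "(1 - \<epsilon>) * b \<le> a"
      using a ab(1) by (smt (verit) mult_nonpos_nonneg)
    then show ?thesis using ab(1) by (simp add: le_divide_eq)
  qed
  ultimately show ?thesis by linarith
qed

text \<open>Under the coupling the pair is a function of the exponential weights, so it suffices to exclude
  an event \<open>A n\<close> of small probability in their space.\<close>

lemma tendsto_in_prob_ratio:
  assumes \<phi>: "\<phi> \<in> borel_measurable borel"
    and F: "F \<le> sequentially"
    and \<Phi>: "\<And>n. \<Phi> n \<in> borel_measurable (\<Pi>\<^sub>M e\<in>edges (complete_graph n). borel)"
    and close: "\<And>\<delta>. 0 < \<delta> \<Longrightarrow> \<delta> \<le> 1 \<Longrightarrow> \<exists>A. (\<forall>n. A n \<in> sets (exp_weight_law n)) \<and>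
      (\<lambda>n. measure (exp_weight_law n) (A n)) \<longlonglongrightarrow> 0 \<and>
      (\<forall>\<^sub>F n in F. \<forall>x\<in>space (exp_weight_law n) - A n. 
         comparable ((1 + \<delta>)\<^sup>2) (\<Phi> n (image_weights n \<phi> x)) (\<Phi> n x))"
  shows "tendsto_in_prob (\<lambda>n. exp_coupling n \<phi>) (\<lambda>n (z, x). \<Phi> n z / \<Phi> n x) 1 F"
  unfolding tendsto_in_prob_def
proof (intro conjI allI impI)
  fix n
  let ?B = "\<Pi>\<^sub>M e\<in>edges (complete_graph n). (borel :: real measure)"
  have \<Phi>': "\<Phi> n \<in> borel_measurable (exp_weight_law n)"
    using \<Phi> unfolding measurable_cong_sets[OF sets_exp_weight_law refl] .
  have "(\<lambda>(z, x). \<Phi> n z / \<Phi> n x) \<in> borel_measurable (?B \<Otimes>\<^sub>M exp_weight_law n)"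
    unfolding case_prod_beta
    by (intro borel_measurable_divide measurable_compose[OF measurable_fst \<Phi>] measurable_compose[OF measurable_snd \<Phi>'])
  then show "(\<lambda>(z, x). \<Phi> n z / \<Phi> n x) \<in> borel_measurable (exp_coupling n \<phi>)"
    unfolding exp_coupling_def by simp
next
  fix \<epsilon> :: real assume \<epsilon>: "0 < \<epsilon>"
  define \<delta> where "\<delta> = min 1 (\<epsilon> / 3)"
  have \<delta>: "0 < \<delta>" "\<delta> \<le> 1" "3 * \<delta> \<le> \<epsilon>" using \<epsilon> by (auto simp: \<delta>_def)
  from close[OF \<delta>(1,2)] obtain A where A: "\<And>n. A n \<in> sets (exp_weight_law n)"
    "(\<lambda>n. measure (exp_weight_law n) (A n)) \<longlonglongrightarrow> 0"
    and ev: "\<forall>\<^sub>F n in F. \<forall>x\<in>space (exp_weight_law n) - A n. 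
         comparable ((1 + \<delta>)\<^sup>2) (\<Phi> n (image_weights n \<phi> x)) (\<Phi> n x)"
    by blast
  let ?D = "\<lambda>n. {\<omega>\<in>space (exp_coupling n \<phi>). \<epsilon> < \<bar>(case \<omega> of (z, x) \<Rightarrow> \<Phi> n z / \<Phi> n x) - 1\<bar>}"
  have "\<forall>\<^sub>F n in F. measure (exp_coupling n \<phi>) (?D n) \<le> measure (exp_weight_law n) (A n)"
    using ev
  proof eventually_elim
    case (elim n)
    interpret N: prob_space "exp_weight_law n" by (rule prob_space_exp_weight_law)
    let ?T = "\<lambda>x. (image_weights n \<phi> x, x)"
    have sub: "?T -` ?D n \<inter> space (exp_weight_law n) \<subseteq> A n"
    proof
      fix x assume x: "x \<in> ?T -` ?D n \<inter> space (exp_weight_law n)"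
      show "x \<in> A n"
      proof (rule ccontr)
        assume "x \<notin> A n"
        then have "comparable ((1 + \<delta>)\<^sup>2) (\<Phi> n (image_weights n \<phi> x)) (\<Phi> n x)"
          using elim x by blast
        from ratio_near_one[OF this \<delta>] show False using x by auto
      qed
    qed
    show "measure (exp_coupling n \<phi>) (?D n) \<le> measure (exp_weight_law n) (A n)"
    proof (cases "?D n \<in> sets (exp_coupling n \<phi>)")
      case True
      then have "measure (exp_coupling n \<phi>) (?D n) = measure (exp_weight_law n) (?T -` ?D n \<inter> space (exp_weight_law n))"
        unfolding exp_coupling_def
        by (intro measure_distr measurable_coupling_map[OF \<phi>]) (simp add: exp_coupling_def)
      also have "\<dots> \<le> measure (exp_weight_law n) (A n)" by (rule N.finite_measure_mono[OF sub A(1)])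
      finally show ?thesis .
    qed (simp add: measure_notin_sets)
  qed
  moreover have "((\<lambda>n. measure (exp_weight_law n) (A n)) \<longlongrightarrow> 0) F" using A(2) F by (rule tendsto_mono[rotated])
  ultimately show "((\<lambda>n. measure (exp_coupling n \<phi>) (?D n)) \<longlongrightarrow> 0) F"
    by (rule tendsto_sandwich[OF always_eventually[OF allI[OF measure_nonneg]] _ tendsto_const])
qed

context fixed_graph
begin

definition close_minima :: "nat \<Rightarrow> real \<Rightarrow> (nat set \<Rightarrow> real) \<Rightarrow> (nat set \<Rightarrow> real) \<Rightarrow> bool" where
  "close_minima n c z x \<longleftrightarrow> (\<forall>m. 0 \<le> m \<and> m / real n < 1 \<longrightarrow>
     comparable c (min_cover_weight H m n z) (min_cover_weight H m n x) \<and>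
     (v dvd n \<longrightarrow> comparable c (min_factor_weight H m n z) (min_factor_weight H m n x)))"

text \<open>The constants are chosen in the order \<open>r\<close>, \<open>\<theta>\<close>, \<open>\<eta>\<close>, \<open>\<rho>\<close>, \<open>\<eta>'\<close>: the light graph for \<open>\<eta>\<close>
  provides the repairs, and its robustness constant \<open>\<rho>\<close> determines how few heavy copies are
  needed and thus how small \<open>\<eta>'\<close> has to be. The exceptional event does not depend on \<open>m\<close>.\<close>

lemma coupled_minima_close:
  assumes "mono \<phi>" and pos: "\<And>x. 0 < x \<Longrightarrow> 0 < \<phi> x"
    and near: "\<And>\<delta>. 0 < \<delta> \<Longrightarrow> \<exists>r>0. \<forall>x. 0 < x \<and> x \<le> r \<longrightarrow> x \<le> (1 + \<delta>) * \<phi> x \<and> \<phi> x \<le> (1 + \<delta>) * x"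
    and \<delta>: "0 < \<delta>" "\<delta> \<le> 1"
  obtains A where "\<forall>n. A n \<in> sets (exp_weight_law n)"
    "(\<lambda>n. measure (exp_weight_law n) (A n)) \<longlonglongrightarrow> 0"
    "\<forall>\<^sub>F n in sequentially. \<forall>x\<in>space (exp_weight_law n) - A n.
       close_minima n ((1 + \<delta>)\<^sup>2) (image_weights n \<phi> x) x"
proof -
  obtain r where r: "0 < r"
    "\<And>x. 0 < x \<Longrightarrow> x \<le> r \<Longrightarrow> x \<le> (1 + \<delta>) * \<phi> x \<and> \<phi> x \<le> (1 + \<delta>) * x"
    using near[OF \<delta>(1)] by blast
  define \<theta> where "\<theta> = r / 2"
  have \<theta>: "0 < \<theta>" using r by (simp add: \<theta>_def)
  have c: "0 < real (v\<^sup>2) * real eH" "0 < real v * real eH" using v_ge_2 eH_pos by auto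
  define \<eta> where "\<eta> = min r (\<delta> * \<theta> / (2 * (real (v\<^sup>2) * real eH)))"
  have \<eta>0: "0 < \<eta>" "\<eta> \<le> r" using r \<delta> \<theta> c by (auto simp: \<eta>_def)
  have "\<eta> \<le> \<delta> * \<theta> / (2 * (real (v\<^sup>2) * real eH))" by (simp add: \<eta>_def)
  then have small: "real (v\<^sup>2) * (real eH * (2 * \<eta>)) \<le> \<delta> * \<theta>"
    using c(1) by (simp add: pos_le_divide_eq algebra_simps)
  obtain \<rho> \<tau> where rob: "0 < \<rho>" "\<forall>\<^sub>F n in sequentially. \<rho> * real n \<le> real (\<tau> n)"
    "(\<lambda>n. measure (exp_weight_law n)
        {x\<in>space (exp_weight_law n). \<not> robust n v (\<tau> n) (light_edges n \<eta> x)}) \<longlonglongrightarrow> 0"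
    using robust_whp[OF \<eta>0(1) v_ge_2] by blast
  define \<eta>' where "\<eta>' = min r (\<rho> * \<theta> / (2 * (real v * real eH)))"
  have \<eta>'0: "0 < \<eta>'" "\<eta>' \<le> r" using r rob(1) \<theta> c by (auto simp: \<eta>'_def)
  have "\<eta>' \<le> \<rho> * \<theta> / (2 * (real v * real eH))" by (simp add: \<eta>'_def)
  then have few0: "real v * (real eH * (2 * \<eta>')) \<le> \<rho> * \<theta>"
    using c(2) by (simp add: pos_le_divide_eq algebra_simps)
  obtain \<rho>' \<tau>' where rob': "0 < \<rho>'" "\<forall>\<^sub>F n in sequentially. \<rho>' * real n \<le> real (\<tau>' n)"
    "(\<lambda>n. measure (exp_weight_law n)
        {x\<in>space (exp_weight_law n). \<not> robust n v (\<tau>' n) (light_edges n \<eta>' x)}) \<longlonglongrightarrow> 0"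
    using robust_whp[OF \<eta>'0(1) v_ge_2] by blast
  define A1 where "A1 n = {x\<in>space (exp_weight_law n). \<not> robust n v (\<tau> n) (light_edges n \<eta> x)}" for n
  define A2 where "A2 n = {x\<in>space (exp_weight_law n). \<not> robust n v (\<tau>' n) (light_edges n \<eta>' x)}" for n
  define A3 where "A3 n = {x\<in>space (exp_weight_law n). light_edges n 0 x \<noteq> {}}" for n
  define A where "A n = A1 n \<union> A2 n \<union> A3 n" for n
  have sets: "A1 n \<in> sets (exp_weight_law n)" "A2 n \<in> sets (exp_weight_law n)"
    "A3 n \<in> sets (exp_weight_law n)" for n
    unfolding A1_def A2_def A3_def by (rule light_edges_event)+
  have A3: "measure (exp_weight_law n) (A3 n) = 0" for n
  proof -
    interpret prob_space "exp_weight_law n" by (rule prob_space_exp_weight_law)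
    have "prob (A3 n) = prob (\<Union>e\<in>edges (complete_graph n). {x\<in>space (exp_weight_law n). x e \<le> 0})"
      by (intro arg_cong[where f = prob]) (auto simp: A3_def light_edges_def)
    also have "\<dots> \<le> (\<Sum>e\<in>edges (complete_graph n). prob {x\<in>space (exp_weight_law n). x e \<le> 0})"
      by (intro finite_measure_subadditive_finite) auto
    also have "\<dots> = 0" using prob_exp_weight_le[of _ n 0] by simp
    finally show ?thesis using measure_nonneg[of "exp_weight_law n" "A3 n"] by linarith
  qed
  have Ale: "measure (exp_weight_law n) (A n) \<le>
      measure (exp_weight_law n) (A1 n) + measure (exp_weight_law n) (A2 n)" for n
    using measure_Un_le[OF sets.Un[OF sets(1,2)[of n]] sets(3)[of n]]
      measure_Un_le[OF sets(1,2)[of n]] A3[of n]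
    unfolding A_def by linarith
  have "(\<lambda>n. measure (exp_weight_law n) (A1 n) + measure (exp_weight_law n) (A2 n)) \<longlonglongrightarrow> 0"
    using tendsto_add[OF rob(3) rob'(3)] unfolding A1_def A2_def by simp
  then have lim: "(\<lambda>n. measure (exp_weight_law n) (A n)) \<longlonglongrightarrow> 0"
    by (rule tendsto_sandwich[OF _ _ tendsto_const, rotated 2]) (use Ale in auto)
  have "\<forall>\<^sub>F n in sequentially. \<rho> * real n \<le> real (\<tau> n) \<and> 0 < n"
    using rob(2) eventually_gt_at_top[of 0] by eventually_elim simp
  then have main: "\<forall>\<^sub>F n in sequentially. \<forall>x\<in>space (exp_weight_law n) - A n.
      close_minima n ((1 + \<delta>)\<^sup>2) (image_weights n \<phi> x) x"
  proof eventually_elim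
    case (elim n)
    then have n: "0 < n" and \<tau>: "\<rho> * real n \<le> real (\<tau> n)" by auto
    show ?case
      unfolding close_minima_def
    proof (intro ballI allI impI, elim conjE)
      fix x m assume x: "x \<in> space (exp_weight_law n) - A n" and m: "0 \<le> m" "m / real n < 1"
      let ?E = "edges (complete_graph n)" and ?z = "image_weights n \<phi> x"
      have R: "robust n v (\<tau> n) (light_edges n \<eta> x)" and R': "robust n v (\<tau>' n) (light_edges n \<eta>' x)"
        using x by (auto simp: A_def A1_def A2_def)
      have xpos: "0 < x e" if "e \<in> ?E" for e
        using x that by (force simp: A_def A3_def light_edges_def)
      have z: "?z e = \<phi> (x e)" if "e \<in> ?E" for e using that by (simp add: image_weights_def)
      have zpos: "0 < ?z e" if "e \<in> ?E" for e using z[OF that] pos xpos[OF that] by simp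
      have LE: "light_edges n a x \<subseteq> ?E" for a by (auto simp: light_edges_def)
      have near_x: "x e \<le> (1 + \<delta>) * ?z e" "?z e \<le> (1 + \<delta>) * x e"
        if "e \<in> light_edges n r x" for e
        using that r(2)[of "x e"] xpos[of e] z[of e] by (auto simp: light_edges_def)
      have light_x: "x e \<le> 2 * a" if "e \<in> light_edges n a x" "0 < a" for e a
        using that by (auto simp: light_edges_def)
      have light_z: "?z e \<le> 2 * a" if "e \<in> light_edges n a x" "0 < a" "a \<le> r" for e a
      proof -
        have e: "e \<in> ?E" "x e \<le> a" using that by (auto simp: light_edges_def)
        then have "?z e \<le> (1 + \<delta>) * x e" using near_x(2)[of e] that by (auto simp: light_edges_def)
        also have "\<dots> \<le> 2 * a" using e xpos[of e] \<delta> by (intro mult_mono) auto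
        finally show ?thesis .
      qed
      have heavy_x: "\<theta> \<le> x e" if "e \<in> ?E" "e \<notin> light_edges n r x" for e
        using that r(1) by (auto simp: light_edges_def \<theta>_def)
      have heavy_z: "\<theta> \<le> ?z e" if "e \<in> ?E" "e \<notin> light_edges n r x" for e
      proof -
        have "r \<le> (1 + \<delta>) * \<phi> r" using r by auto
        also have "\<dots> \<le> 2 * \<phi> r" using \<delta> pos[OF r(1)] by (intro mult_right_mono) auto
        finally have "\<theta> \<le> \<phi> r" by (simp add: \<theta>_def)
        also have "\<phi> r \<le> ?z e"
          using that monoD[OF \<open>mono \<phi>\<close>, of r "x e"] z[of e] by (auto simp: light_edges_def)
        finally show ?thesis .
      qed
      have few: "real v * (real n * (real eH * (2 * \<eta>'))) \<le> real (\<tau> n) * \<theta>"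
      proof -
        have "real v * (real n * (real eH * (2 * \<eta>'))) = real n * (real v * (real eH * (2 * \<eta>')))" by simp
        also have "\<dots> \<le> real n * (\<rho> * \<theta>)" using few0 by (intro mult_left_mono) auto
        also have "\<dots> = \<rho> * real n * \<theta>" by simp
        also have "\<dots> \<le> real (\<tau> n) * \<theta>" using \<tau> \<theta> by (intro mult_right_mono) auto
        finally show ?thesis .
      qed
      have sub: "light_edges n \<eta> x \<subseteq> light_edges n r x" using \<eta>0 by (auto simp: light_edges_def)
      have cov: "0 < min_cover_weight H m n x"
        by (rule min_cover_weight_pos[OF n m(2,1) R LE xpos])
      have cov_zx: "min_cover_weight H m n ?z \<le> (1 + \<delta>)\<^sup>2 * min_cover_weight H m n x"
        by (rule cover_transfer[OF m(1) n R LE, where \<beta> = "2 * \<eta>" and \<theta> = \<theta> and L = "light_edges n r x"])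
          (use xpos light_x \<eta>0 sub heavy_x small near_x \<delta> in \<open>auto intro: less_imp_le\<close>)
      have cov_xz: "min_cover_weight H m n x \<le> (1 + \<delta>)\<^sup>2 * min_cover_weight H m n ?z"
        by (rule cover_transfer[OF m(1) n R LE, where \<beta> = "2 * \<eta>" and \<theta> = \<theta> and L = "light_edges n r x"])
          (use zpos light_z \<eta>0 sub heavy_z small near_x \<delta> in \<open>auto intro: less_imp_le\<close>)
      have fac: "comparable ((1 + \<delta>)\<^sup>2) (min_factor_weight H m n ?z) (min_factor_weight H m n x)" if dvd: "v dvd n"
        unfolding comparable_def
      proof (intro conjI)
        show "0 < min_factor_weight H m n x"
          by (rule min_factor_weight_pos[OF n m(2,1) dvd xpos])
        show "min_factor_weight H m n ?z \<le> (1 + \<delta>)\<^sup>2 * min_factor_weight H m n x"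
          by (rule factor_transfer[OF dvd m(1) n R R', where \<beta> = "2 * \<eta>" and \<beta>' = "2 * \<eta>'" and \<theta> = \<theta>
              and L = "light_edges n r x"])
            (use xpos light_x \<eta>0 \<eta>'0 sub heavy_x small few near_x \<delta> \<theta> in \<open>auto intro: less_imp_le\<close>)
        show "min_factor_weight H m n x \<le> (1 + \<delta>)\<^sup>2 * min_factor_weight H m n ?z"
          by (rule factor_transfer[OF dvd m(1) n R R', where \<beta> = "2 * \<eta>" and \<beta>' = "2 * \<eta>'" and \<theta> = \<theta>
              and L = "light_edges n r x"])
            (use zpos light_z \<eta>0 \<eta>'0 sub heavy_z small few near_x \<delta> \<theta> in \<open>auto intro: less_imp_le\<close>)
      qed
      show "comparable ((1 + \<delta>)\<^sup>2) (min_cover_weight H m n ?z) (min_cover_weight H m n x) \<and>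
        (v dvd n \<longrightarrow> comparable ((1 + \<delta>)\<^sup>2) (min_factor_weight H m n ?z) (min_factor_weight H m n x))"
        using cov cov_zx cov_xz fac by (simp add: comparable_def)
    qed
  qed
  have "\<forall>n. A n \<in> sets (exp_weight_law n)" using sets unfolding A_def by blast
  from that[OF this lim main] show ?thesis .
qed

end

theorem theorem5p1:
  fixes H :: "'a graph"
    and G :: "real \<Rightarrow> real"
    and M :: "nat \<Rightarrow> 'w measure"
    and Z :: "nat \<Rightarrow> nat set \<Rightarrow> 'w \<Rightarrow> real"
  assumes "finite_simple_graph H" and "edges H \<noteq> {}"
    and "\<And>n. prob_space (M n)"
    and "\<And>n. prob_space.indep_vars (M n) (\<lambda>_. borel) (Z n) (edges (complete_graph n))"
    and "\<And>n e. e \<in> edges (complete_graph n) \<Longrightarrow> cdf (distr (M n) borel (Z n e)) = G"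
    and "\<And>n e. e \<in> edges (complete_graph n) \<Longrightarrow> AE \<omega> in M n. 0 < Z n e \<omega>"
    and "((\<lambda>x. G x / x) \<longlongrightarrow> 1) (at_right 0)"
  shows "\<exists>P :: nat \<Rightarrow> ((nat set \<Rightarrow> real) \<times> (nat set \<Rightarrow> real)) measure.
    (\<forall>n. is_coupling (P n) (weight_law n (M n) (Z n)) (exp_weight_law n)) \<and>
    (\<forall>(m :: nat \<Rightarrow> real) c.
       (\<forall>n. 0 \<le> m n) \<and> c < 1 \<and>
       ((\<lambda>n. m n / real n) \<longlongrightarrow> c)
         (inf sequentially (principal {n. card (verts H) dvd n})) \<longrightarrow>
       tendsto_in_prob P
         (\<lambda>n (z, x). min_factor_weight H (m n) n z / min_factor_weight H (m n) n x) 1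
         (inf sequentially (principal {n. card (verts H) dvd n}))) \<and>
    (\<forall>(m :: nat \<Rightarrow> real) c.
       (\<forall>n. 0 \<le> m n) \<and> c < 1 \<and>
       ((\<lambda>n. m n / real n) \<longlongrightarrow> c) sequentially \<longrightarrow>
       tendsto_in_prob P
         (\<lambda>n (z, x). min_cover_weight H (m n) n z / min_cover_weight H (m n) n x) 1
         sequentially)"
proof -
  interpret fixed_graph H using assms(1,2) by unfold_locales
  let ?E = "\<lambda>n. edges (complete_graph n)"
  define \<nu> where "\<nu> = distr (M 2) borel (Z 2 {0, 1})"
  have rv: "Z n e \<in> borel_measurable (M n)" if "e \<in> ?E n" for n e
    using assms(4)[of n] that by (simp add: prob_space.indep_vars_def[OF assms(3)])
  have rd: "real_distribution (distr (M n) borel (Z n e))" if "e \<in> ?E n" for n e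
    by (intro real_distribution.intro prob_space.prob_space_distr[OF assms(3) rv[OF that]] real_distribution_axioms.intro) auto
  have e01: "{0, 1} \<in> ?E 2" by (auto simp: edge_complete_iff)
  have \<nu>: "real_distribution \<nu>" "cdf \<nu> = G"
    using rd[OF e01] assms(5)[OF e01] by (auto simp: \<nu>_def)
  have Z\<nu>: "distr (M n) borel (Z n e) = \<nu>" if "e \<in> ?E n" for n e
    using cdf_unique[OF rd[OF that] \<nu>(1)] assms(5)[OF that] \<nu>(2) by simp
  obtain \<phi> where \<phi>: "mono \<phi>" "\<And>x. 0 < x \<Longrightarrow> 0 < \<phi> x" "distr exp_law borel \<phi> = \<nu>"
    "\<And>\<delta>. 0 < \<delta> \<Longrightarrow> \<exists>r>0. \<forall>x. 0 < x \<and> x \<le> r \<longrightarrow> x \<le> (1 + \<delta>) * \<phi> x \<and> \<phi> x \<le> (1 + \<delta>) * x"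
    using quantile_transform[OF \<nu>(1)] assms(7) unfolding \<nu>(2) by blast
  have m\<phi>: "\<phi> \<in> borel_measurable borel" using \<phi>(1) by (rule borel_measurable_mono)
  let ?P = "\<lambda>n. exp_coupling n \<phi>"
  have "is_coupling (?P n) (weight_law n (M n) (Z n)) (exp_weight_law n)" for n
    by (intro is_coupling_exp_coupling[OF m\<phi>] distr_image_weights[OF m\<phi> \<phi>(3) assms(3,4) Z\<nu>])
  moreover have "tendsto_in_prob ?P
         (\<lambda>n (z, x). min_factor_weight H (m n) n z / min_factor_weight H (m n) n x) 1
         (inf sequentially (principal {n. v dvd n}))" (is "tendsto_in_prob _ _ _ ?F")
    if m: "\<forall>n. 0 \<le> m n" "c < 1" "((\<lambda>n. m n / real n) \<longlongrightarrow> c) (inf sequentially (principal {n. v dvd n}))"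
    for m c
  proof (rule tendsto_in_prob_ratio[OF m\<phi> inf_le1 borel_measurable_min_factor_weight])
    fix \<delta> :: real assume \<delta>: "0 < \<delta>" "\<delta> \<le> 1"
    obtain A where A: "\<forall>n. A n \<in> sets (exp_weight_law n)" "(\<lambda>n. measure (exp_weight_law n) (A n)) \<longlonglongrightarrow> 0"
      and ev: "\<forall>\<^sub>F n in sequentially. \<forall>x\<in>space (exp_weight_law n) - A n.
        close_minima n ((1 + \<delta>)\<^sup>2) (image_weights n \<phi> x) x"
      by (rule coupled_minima_close[OF \<phi>(1,2,4) \<delta>])
    have "\<forall>\<^sub>F n in ?F. \<forall>x\<in>space (exp_weight_law n) - A n. comparable ((1 + \<delta>)\<^sup>2) (min_factor_weight H (m n) n (image_weights n \<phi> x)) (min_factor_weight H (m n) n x)"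
      using order_tendstoD(2)[OF m(3,2)] ev unfolding eventually_inf_principal close_minima_def by eventually_elim (use m(1) in blast)
    with A show "\<exists>A. (\<forall>n. A n \<in> sets (exp_weight_law n)) \<and>
      (\<lambda>n. measure (exp_weight_law n) (A n)) \<longlonglongrightarrow> 0 \<and>
      (\<forall>\<^sub>F n in ?F. \<forall>x\<in>space (exp_weight_law n) - A n. comparable ((1 + \<delta>)\<^sup>2) (min_factor_weight H (m n) n (image_weights n \<phi> x)) (min_factor_weight H (m n) n x))"
      by blast
  qed
  moreover have "tendsto_in_prob ?P
         (\<lambda>n (z, x). min_cover_weight H (m n) n z / min_cover_weight H (m n) n x) 1 sequentially"
    if m: "\<forall>n. 0 \<le> m n" "c < 1" "((\<lambda>n. m n / real n) \<longlongrightarrow> c) sequentially" for m c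
  proof (rule tendsto_in_prob_ratio[OF m\<phi> order_refl borel_measurable_min_cover_weight])
    fix \<delta> :: real assume \<delta>: "0 < \<delta>" "\<delta> \<le> 1"
    obtain A where A: "\<forall>n. A n \<in> sets (exp_weight_law n)" "(\<lambda>n. measure (exp_weight_law n) (A n)) \<longlonglongrightarrow> 0"
      and ev: "\<forall>\<^sub>F n in sequentially. \<forall>x\<in>space (exp_weight_law n) - A n.
        close_minima n ((1 + \<delta>)\<^sup>2) (image_weights n \<phi> x) x"
      by (rule coupled_minima_close[OF \<phi>(1,2,4) \<delta>])
    have "\<forall>\<^sub>F n in sequentially. \<forall>x\<in>space (exp_weight_law n) - A n. comparable ((1 + \<delta>)\<^sup>2) (min_cover_weight H (m n) n (image_weights n \<phi> x)) (min_cover_weight H (m n) n x)"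
      using order_tendstoD(2)[OF m(3,2)] ev
      unfolding close_minima_def by eventually_elim (use m(1) in blast)
    with A show "\<exists>A. (\<forall>n. A n \<in> sets (exp_weight_law n)) \<and>
      (\<lambda>n. measure (exp_weight_law n) (A n)) \<longlonglongrightarrow> 0 \<and>
      (\<forall>\<^sub>F n in sequentially. \<forall>x\<in>space (exp_weight_law n) - A n. comparable ((1 + \<delta>)\<^sup>2) (min_cover_weight H (m n) n (image_weights n \<phi> x)) (min_cover_weight H (m n) n x))"
      by blast
  qed
  ultimately show ?thesis by (intro exI[of _ ?P]) blast
qed

end
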